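(* Let $\mathsf{p}:P\to M$ be a principal fibre bundle with structure Lie group $G$, let $\star$ be a star product on $M$, and let $\bullet$ be a deformation quantization of the principal fibre bundle with respect to $\star$. Let $\pi:G\to\mathrm{End}(V)$ be a representation of $G$ on a finite dimensional complex vector space $V$ and let $E=P\times_GV$ be the associated vector bundle. Then the right multiplication $(h\otimes w)\bullet a=(h\bullet a)\otimes w$ on $C^\infty(P)[[\lambda]]\otimes V$ restricts to $(C^\infty(P)\otimes V)^G[[\lambda]]$, and via the isomorphism $\Gamma^\infty(P\times_GV)\cong(C^\infty(P)\otimes V)^G$ it defines a deformation quantization of the vector bundle $E$ with respect to $\star$.
   Context: All functions and sections are smooth, functions complex valued; $\lambda$ is a formal parameter; maps are extended $\mathbb{C}[[\lambda]]$-(multi)linearly. The principal right action is $\mathsf{r}_g:P\to P$, $g\in G$. Star product: an associative $\mathbb{C}[[\lambda]]$-bilinear product $a \star b = \sum_{r\ge0} \lambda^r C_r(a,b)$ on $C^\infty(M)[[\lambda]]$ with $C_0(a,b)=ab$, all $C_r$ bidifferential, $1\star a = a = a\star 1$. Deformation quantization of the principal fibre bundle with respect to $\star$: a right module structure $\bullet$ of $(C^\infty(M)[[\lambda]],\star)$ on $C^\infty(P)[[\lambda]]$ of the form $f\bullet a = f\cdot \mathsf{p}^*a + \sum_{r\ge1} \lambda^r \rho_r(f,a)$ with bidifferential $\rho_r$, such that $\mathsf{r}_g^*(f\bullet a)=(\mathsf{r}_g^*f)\bullet a$ for all $g\in G$. $(C^\infty(P)\otimes V)^G$ denotes the invariants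 under the left action $\mathsf{r}_g^*\otimes\pi(g)$ of $G$ on $C^\infty(P)\otimes V$ ($V$-valued functions on $P$); it is canonically isomorphic to $\Gamma^\infty(P\times_GV)$ as a $C^\infty(M)$-module. Deformation quantization of a vector bundle $E\to M$ with respect to $\star$: a right module structure of $(C^\infty(M)[[\lambda]],\star)$ on $\Gamma^\infty(E)[[\lambda]]$ of the form $s\bullet a=s\cdot a+\sum_{r\ge1}\lambda^rR_r(s,a)$ with $\mathbb{C}$-bilinear maps $R_r:\Gamma^\infty(E)\times C^\infty(M)\to\Gamma^\infty(E)$. *)

theory Defs
  imports "HOL-Analysis.Analysis"
begin

section \<open>Smooth manifolds\<close>

text \<open>
  Model spaces are finite-dimensional real normed spaces rather than types of class
  \<open>euclidean_space\<close>, because that class excludes dimension 0 (discrete groups, zero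
  representation).
\<close>

primrec times_diff :: "nat \<Rightarrow> 'a::real_normed_vector set \<Rightarrow> ('a \<Rightarrow> 'b::real_normed_vector) \<Rightarrow> bool"
  where
    "times_diff 0 S f \<longleftrightarrow> continuous_on S f"
  | "times_diff (Suc n) S f \<longleftrightarrow>
       (\<forall>x\<in>S. f differentiable (at x)) \<and>
       (\<forall>v. times_diff n S (\<lambda>x. frechet_derivative f (at x) v))"

text \<open>Only used for open sets \<open>S\<close> in finite-dimensional spaces.\<close>

definition smooth_on :: "'a::real_normed_vector set \<Rightarrow> ('a \<Rightarrow> 'b::real_normed_vector) \<Rightarrow> bool"
  where "smooth_on S f \<longleftrightarrow> (\<forall>n. times_diff n S f)"

type_synonym ('a, 'e) chart = "'a set \<times> ('a \<Rightarrow> 'e)"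
type_synonym ('a, 'e) atlas = "('a, 'e) chart set"

definition smooth_manifold ::
  "('a::{t2_space,second_countable_topology}, 'e::real_normed_vector) atlas \<Rightarrow> bool"
  where
    "smooth_manifold A \<longleftrightarrow>
       (\<exists>B::'e set. finite B \<and> span B = UNIV) \<and>
       (\<forall>(U, \<phi>) \<in> A. open U \<and> open (\<phi> ` U) \<and> homeomorphism U (\<phi> ` U) \<phi> (inv_into U \<phi>)) \<and>
       (\<Union>(U, \<phi>) \<in> A. U) = UNIV \<and>
       (\<forall>(U, \<phi>) \<in> A. \<forall>(V, \<psi>) \<in> A. smooth_on (\<phi> ` (U \<inter> V)) (\<psi> \<circ> inv_into U \<phi>))"

definition vector_atlas :: "('e, 'e) atlas"
  where "vector_atlas = {(UNIV, \<lambda>x. x)}"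

definition prod_atlas :: "('a, 'e) atlas \<Rightarrow> ('b, 'f) atlas \<Rightarrow> ('a \<times> 'b, 'e \<times> 'f) atlas"
  where "prod_atlas A B = {(U \<times> V, map_prod \<phi> \<psi>) |U \<phi> V \<psi>. (U, \<phi>) \<in> A \<and> (V, \<psi>) \<in> B}"

text \<open>
  Smoothness on an open set \<open>S\<close>: around each point there is an open \<open>W\<close> inside a chart domain
  that is mapped into a chart domain of the target.  Openness of \<open>W\<close> is expressed in the chart, so
  that no topology is needed on total spaces given by an atlas only.
\<close>

definition smooth_map_on ::
  "('a, 'e::real_normed_vector) atlas \<Rightarrow> ('b, 'f::real_normed_vector) atlas \<Rightarrow> 'a set \<Rightarrow> ('a \<Rightarrow> 'b) \<Rightarrow> bool"
  where
    "smooth_map_on A B S f \<longleftrightarrow>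
       (\<forall>x\<in>S. \<exists>(U, \<phi>) \<in> A. \<exists>(V, \<psi>) \<in> B. \<exists>W.
          x \<in> W \<and> W \<subseteq> U \<inter> S \<and> open (\<phi> ` W) \<and> f ` W \<subseteq> V \<and>
          smooth_on (\<phi> ` W) (\<psi> \<circ> f \<circ> inv_into U \<phi>))"

section \<open>Principal fibre bundles\<close>

text \<open>The total space, the base and the group are the full types; \<open>act u g\<close> is the right action.\<close>

record ('p, 'ep, 'm, 'em, 'g, 'eg) pfb =
  tot_atlas :: "('p, 'ep) atlas"
  base_atlas :: "('m, 'em) atlas"
  grp_atlas :: "('g, 'eg) atlas"
  gmul :: "'g \<Rightarrow> 'g \<Rightarrow> 'g"
  gone :: 'g
  ginv :: "'g \<Rightarrow> 'g"
  act :: "'p \<Rightarrow> 'g \<Rightarrow> 'p"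
  prj :: "'p \<Rightarrow> 'm"

definition lie_group ::
  "('g::{t2_space,second_countable_topology}, 'eg::real_normed_vector) atlas \<Rightarrow>
   ('g \<Rightarrow> 'g \<Rightarrow> 'g) \<Rightarrow> 'g \<Rightarrow> ('g \<Rightarrow> 'g) \<Rightarrow> bool"
  where
    "lie_group A mul e iv \<longleftrightarrow>
       Groups.group mul e iv \<and> smooth_manifold A \<and>
       smooth_map_on (prod_atlas A A) A UNIV (\<lambda>(g, h). mul g h) \<and>
       smooth_map_on A A UNIV iv"

text \<open>
  A local trivialisation over \<open>U\<close> is an equivariant diffeomorphism
  \<open>u \<mapsto> (prj u, \<gamma> u)\<close> from the part of the total space over \<open>U\<close> onto \<open>U \<times> G\<close>.
\<close>

definition local_triv ::
  "('p, 'ep::real_normed_vector, 'm::topological_space, 'em::real_normed_vector, 'g, 'eg::real_normed_vector) pfb \<Rightarrow>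
   'm set \<Rightarrow> ('p \<Rightarrow> 'g) \<Rightarrow> bool"
  where
    "local_triv P U \<gamma> \<longleftrightarrow>
       open U \<and>
       bij_betw (\<lambda>u. (prj P u, \<gamma> u)) (prj P -` U) (U \<times> UNIV) \<and>
       smooth_map_on (tot_atlas P) (prod_atlas (base_atlas P) (grp_atlas P))
         (prj P -` U) (\<lambda>u. (prj P u, \<gamma> u)) \<and>
       smooth_map_on (prod_atlas (base_atlas P) (grp_atlas P)) (tot_atlas P)
         (U \<times> UNIV) (inv_into (prj P -` U) (\<lambda>u. (prj P u, \<gamma> u))) \<and>
       (\<forall>u \<in> prj P -` U. \<forall>g. \<gamma> (act P u g) = gmul P (\<gamma> u) g)"

definition principal_fibre_bundle ::
  "('p::{t2_space,second_countable_topology}, 'ep::real_normed_vector,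
    'm::{t2_space,second_countable_topology}, 'em::real_normed_vector,
    'g::{t2_space,second_countable_topology}, 'eg::real_normed_vector) pfb \<Rightarrow> bool"
  where
    "principal_fibre_bundle P \<longleftrightarrow>
       smooth_manifold (tot_atlas P) \<and> smooth_manifold (base_atlas P) \<and>
       lie_group (grp_atlas P) (gmul P) (gone P) (ginv P) \<and>
       smooth_map_on (tot_atlas P) (base_atlas P) UNIV (prj P) \<and>
       smooth_map_on (prod_atlas (tot_atlas P) (grp_atlas P)) (tot_atlas P) UNIV (\<lambda>(u, g). act P u g) \<and>
       (\<forall>u. act P u (gone P) = u) \<and>
       (\<forall>u g h. act P (act P u g) h = act P u (gmul P g h)) \<and>
       (\<forall>u g. prj P (act P u g) = prj P u) \<and>
       (\<forall>x. \<exists>U \<gamma>. x \<in> U \<and> local_triv P U \<gamma>)"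

section \<open>Formal power series and \<open>\<lambda>\<close>-extended bilinear maps\<close>

text \<open>
  A complex vector space on a carrier set; used for spaces of functions and of sections.
\<close>

record 'a cspace =
  carr :: "'a set"
  vadd :: "'a \<Rightarrow> 'a \<Rightarrow> 'a"
  vzero :: 'a
  vscale :: "complex \<Rightarrow> 'a \<Rightarrow> 'a"

text \<open>The series with coefficients \<open>F n\<close> of \<open>\<lambda>^n\<close> is the sequence \<open>F\<close>.\<close>

definition formal :: "'a cspace \<Rightarrow> (nat \<Rightarrow> 'a) set"
  where "formal S = {F. \<forall>n. F n \<in> carr S}"

definition cbilinear :: "'a cspace \<Rightarrow> 'b cspace \<Rightarrow> 'c cspace \<Rightarrow> ('a \<Rightarrow> 'b \<Rightarrow> 'c) \<Rightarrow> bool"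
  where
    "cbilinear X Y Z D \<longleftrightarrow>
       (\<forall>x\<in>carr X. \<forall>y\<in>carr Y. D x y \<in> carr Z) \<and>
       (\<forall>x\<in>carr X. \<forall>x'\<in>carr X. \<forall>y\<in>carr Y. D (vadd X x x') y = vadd Z (D x y) (D x' y)) \<and>
       (\<forall>x\<in>carr X. \<forall>y\<in>carr Y. \<forall>y'\<in>carr Y. D x (vadd Y y y') = vadd Z (D x y) (D x y')) \<and>
       (\<forall>c. \<forall>x\<in>carr X. \<forall>y\<in>carr Y. D (vscale X c x) y = vscale Z c (D x y)) \<and>
       (\<forall>c. \<forall>x\<in>carr X. \<forall>y\<in>carr Y. D x (vscale Y c y) = vscale Z c (D x y))"

text \<open>
  The \<open>\<lambda>\<close>-bilinear extension of \<open>\<Sum>r. \<lambda>^r D r\<close>: its coefficient at \<open>\<lambda>^n\<close> is the sum of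
  \<open>D r (F i) (a j)\<close> over \<open>r + i + j = n\<close>.
\<close>

definition lambda_ext ::
  "'c cspace \<Rightarrow> (nat \<Rightarrow> 'a \<Rightarrow> 'b \<Rightarrow> 'c) \<Rightarrow> (nat \<Rightarrow> 'a) \<Rightarrow> (nat \<Rightarrow> 'b) \<Rightarrow> nat \<Rightarrow> 'c"
  where
    "lambda_ext Z D F a n =
       foldr (vadd Z) [D r (F i) (a (n - r - i)). r \<leftarrow> [0..<Suc n], i \<leftarrow> [0..<Suc (n - r)]] (vzero Z)"

section \<open>Smooth functions and bidifferential operators\<close>

definition smooth_functions :: "('a, 'e::real_normed_vector) atlas \<Rightarrow> ('a \<Rightarrow> complex) cspace"
  where
    "smooth_functions A =
       \<lparr>carr = {f. smooth_map_on A vector_atlas UNIV f},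
        vadd = (\<lambda>f g x. f x + g x), vzero = (\<lambda>x. 0), vscale = (\<lambda>c f x. c * f x)\<rparr>"

definition formal_one :: "nat \<Rightarrow> 'a \<Rightarrow> complex"
  where "formal_one n = (\<lambda>x. if n = 0 then 1 else 0)"

text \<open>
  Algebraic (Grothendieck) definition of bidifferential operators.  For algebras \<open>A\<close>, \<open>B\<close> of
  functions on \<open>X\<close>, \<open>Y\<close> acting on functions on \<open>Z\<close> by multiplication with pull-backs along
  \<open>q\<^sub>1 : Z \<rightarrow> X\<close>, \<open>q\<^sub>2 : Z \<rightarrow> Y\<close>, a map \<open>D\<close> has order \<open>< k\<close> in the first and \<open>< l\<close> in the
  second argument if its commutators with multiplications in the first (second) argument have
  orders \<open>< k - 1, < l\<close> (\<open>< k, < l - 1\<close>); only the zero map has a negative order.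
\<close>

fun bidiff_below ::
  "('x \<Rightarrow> complex) set \<Rightarrow> ('y \<Rightarrow> complex) set \<Rightarrow> ('z \<Rightarrow> 'x) \<Rightarrow> ('z \<Rightarrow> 'y) \<Rightarrow> nat \<Rightarrow> nat \<Rightarrow>
   (('x \<Rightarrow> complex) \<Rightarrow> ('y \<Rightarrow> complex) \<Rightarrow> 'z \<Rightarrow> complex) \<Rightarrow> bool"
  where
    "bidiff_below A B q1 q2 0 l D \<longleftrightarrow> (\<forall>f\<in>A. \<forall>a\<in>B. \<forall>z. D f a z = 0)"
  | "bidiff_below A B q1 q2 (Suc k) 0 D \<longleftrightarrow> (\<forall>f\<in>A. \<forall>a\<in>B. \<forall>z. D f a z = 0)"
  | "bidiff_below A B q1 q2 (Suc k) (Suc l) D \<longleftrightarrow>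
       (\<forall>h\<in>A. bidiff_below A B q1 q2 k (Suc l)
          (\<lambda>f a z. D (\<lambda>x. h x * f x) a z - h (q1 z) * D f a z)) \<and>
       (\<forall>b\<in>B. bidiff_below A B q1 q2 (Suc k) l
          (\<lambda>f a z. D f (\<lambda>y. b y * a y) z - b (q2 z) * D f a z))"

definition bidifferential ::
  "('x \<Rightarrow> complex) cspace \<Rightarrow> ('y \<Rightarrow> complex) cspace \<Rightarrow> ('z \<Rightarrow> complex) cspace \<Rightarrow>
   ('z \<Rightarrow> 'x) \<Rightarrow> ('z \<Rightarrow> 'y) \<Rightarrow>
   (('x \<Rightarrow> complex) \<Rightarrow> ('y \<Rightarrow> complex) \<Rightarrow> 'z \<Rightarrow> complex) \<Rightarrow> bool"
  where
    "bidifferential X Y Z q1 q2 D \<longleftrightarrow>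
       cbilinear X Y Z D \<and> (\<exists>k l. bidiff_below (carr X) (carr Y) q1 q2 k l D)"

section \<open>Star products and deformation quantizations\<close>

definition star_product ::
  "('m, 'em::real_normed_vector) atlas \<Rightarrow>
   ((nat \<Rightarrow> 'm \<Rightarrow> complex) \<Rightarrow> (nat \<Rightarrow> 'm \<Rightarrow> complex) \<Rightarrow> (nat \<Rightarrow> 'm \<Rightarrow> complex)) \<Rightarrow> bool"
  where
    "star_product AM star \<longleftrightarrow>
       (let CM = smooth_functions AM in
         (\<exists>C. (\<forall>r. bidifferential CM CM CM (\<lambda>x. x) (\<lambda>x. x) (C r)) \<and>
              (\<forall>a\<in>carr CM. \<forall>b\<in>carr CM. C 0 a b = (\<lambda>x. a x * b x)) \<and>
              (\<forall>a\<in>formal CM. \<forall>b\<in>formal CM. star a b = lambda_ext CM C a b)) \<and>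
         (\<forall>a\<in>formal CM. \<forall>b\<in>formal CM. \<forall>c\<in>formal CM. star (star a b) c = star a (star b c)) \<and>
         (\<forall>a\<in>formal CM. star formal_one a = a \<and> star a formal_one = a))"

text \<open>
  The module axioms; \<open>\<complex>[[\<lambda>]]\<close>-bilinearity is part of the form of the module structures below.
\<close>

definition right_module_structure ::
  "('m, 'em::real_normed_vector) atlas \<Rightarrow>
   ((nat \<Rightarrow> 'm \<Rightarrow> complex) \<Rightarrow> (nat \<Rightarrow> 'm \<Rightarrow> complex) \<Rightarrow> (nat \<Rightarrow> 'm \<Rightarrow> complex)) \<Rightarrow>
   's cspace \<Rightarrow> ((nat \<Rightarrow> 's) \<Rightarrow> (nat \<Rightarrow> 'm \<Rightarrow> complex) \<Rightarrow> (nat \<Rightarrow> 's)) \<Rightarrow> bool"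
  where
    "right_module_structure AM star S bul \<longleftrightarrow>
       (\<forall>s\<in>formal S. \<forall>a\<in>formal (smooth_functions AM). bul s a \<in> formal S) \<and>
       (\<forall>s\<in>formal S. bul s formal_one = s) \<and>
       (\<forall>s\<in>formal S. \<forall>a\<in>formal (smooth_functions AM). \<forall>b\<in>formal (smooth_functions AM).
          bul (bul s a) b = bul s (star a b))"

definition pfb_deformation_quantization ::
  "('p, 'ep::real_normed_vector, 'm, 'em::real_normed_vector, 'g, 'eg) pfb \<Rightarrow>
   ((nat \<Rightarrow> 'm \<Rightarrow> complex) \<Rightarrow> (nat \<Rightarrow> 'm \<Rightarrow> complex) \<Rightarrow> (nat \<Rightarrow> 'm \<Rightarrow> complex)) \<Rightarrow>
   ((nat \<Rightarrow> 'p \<Rightarrow> complex) \<Rightarrow> (nat \<Rightarrow> 'm \<Rightarrow> complex) \<Rightarrow> (nat \<Rightarrow> 'p \<Rightarrow> complex)) \<Rightarrow> bool"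
  where
    "pfb_deformation_quantization P star bul \<longleftrightarrow>
       (let CM = smooth_functions (base_atlas P); CP = smooth_functions (tot_atlas P) in
         (\<exists>\<rho>. (\<forall>r. bidifferential CP CM CP (\<lambda>u. u) (prj P) (\<rho> r)) \<and>
              (\<forall>f\<in>carr CP. \<forall>a\<in>carr CM. \<rho> 0 f a = (\<lambda>u. f u * a (prj P u))) \<and>
              (\<forall>f\<in>formal CP. \<forall>a\<in>formal CM. bul f a = lambda_ext CP \<rho> f a)) \<and>
         right_module_structure (base_atlas P) star CP bul \<and>
         (\<forall>g. \<forall>f\<in>formal CP. \<forall>a\<in>formal CM.
            (\<lambda>n u. bul f a n (act P u g)) = bul (\<lambda>n u. f n (act P u g)) a))"

section \<open>Vector bundles\<close>

text \<open>The data of a complex vector bundle over a base whose points are all of type \<open>'m\<close>.\<close>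

record ('e, 'm, 'k) vbundle =
  vb_total :: "'e set"
  vb_proj :: "'e \<Rightarrow> 'm"
  vb_atlas :: "('e, 'k) atlas"
  vb_add :: "'e \<Rightarrow> 'e \<Rightarrow> 'e"
  vb_zero :: "'m \<Rightarrow> 'e"
  vb_scale :: "complex \<Rightarrow> 'e \<Rightarrow> 'e"

definition smooth_sections ::
  "('m, 'em::real_normed_vector) atlas \<Rightarrow> ('e, 'm, 'k::real_normed_vector) vbundle \<Rightarrow> ('m \<Rightarrow> 'e) cspace"
  where
    "smooth_sections AM E =
       \<lparr>carr = {s. (\<forall>x. s x \<in> vb_total E \<and> vb_proj E (s x) = x) \<and>
                   smooth_map_on AM (vb_atlas E) UNIV s},
        vadd = (\<lambda>s t x. vb_add E (s x) (t x)), vzero = vb_zero E,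
        vscale = (\<lambda>c s x. vb_scale E c (s x))\<rparr>"

definition vb_deformation_quantization ::
  "('m, 'em::real_normed_vector) atlas \<Rightarrow> ('e, 'm, 'k::real_normed_vector) vbundle \<Rightarrow>
   ((nat \<Rightarrow> 'm \<Rightarrow> complex) \<Rightarrow> (nat \<Rightarrow> 'm \<Rightarrow> complex) \<Rightarrow> (nat \<Rightarrow> 'm \<Rightarrow> complex)) \<Rightarrow>
   ((nat \<Rightarrow> 'm \<Rightarrow> 'e) \<Rightarrow> (nat \<Rightarrow> 'm \<Rightarrow> complex) \<Rightarrow> (nat \<Rightarrow> 'm \<Rightarrow> 'e)) \<Rightarrow> bool"
  where
    "vb_deformation_quantization AM E star bul \<longleftrightarrow>
       (let CM = smooth_functions AM; \<Gamma> = smooth_sections AM E in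
         (\<exists>R. (\<forall>r. cbilinear \<Gamma> CM \<Gamma> (R r)) \<and>
              (\<forall>s\<in>carr \<Gamma>. \<forall>a\<in>carr CM. R 0 s a = (\<lambda>x. vb_scale E (a x) (s x))) \<and>
              (\<forall>s\<in>formal \<Gamma>. \<forall>a\<in>formal CM. bul s a = lambda_ext \<Gamma> R s a)) \<and>
         right_module_structure AM star \<Gamma> bul)"

section \<open>Representations and associated vector bundles\<close>

text \<open>
  \<open>sc\<close> is a complex scalar multiplication extending the real one of the type.  The norm only serves
  to speak about smoothness; by finite dimension its choice is immaterial.
\<close>

definition fin_dim_complex :: "(complex \<Rightarrow> 'v \<Rightarrow> 'v::real_normed_vector) \<Rightarrow> bool"
  where
    "fin_dim_complex sc \<longleftrightarrow>
       vector_space sc \<and> (\<forall>r v. sc (of_real r) v = r *\<^sub>R v) \<and>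
       (\<exists>B. finite B \<and> module.span sc B = UNIV)"

definition lie_representation ::
  "('p, 'ep, 'm, 'em, 'g, 'eg::real_normed_vector) pfb \<Rightarrow>
   (complex \<Rightarrow> 'v \<Rightarrow> 'v::real_normed_vector) \<Rightarrow> ('g \<Rightarrow> 'v \<Rightarrow> 'v) \<Rightarrow> bool"
  where
    "lie_representation P sc \<pi> \<longleftrightarrow>
       (\<forall>g. Vector_Spaces.linear sc sc (\<pi> g)) \<and>
       \<pi> (gone P) = id \<and>
       (\<forall>g h. \<pi> (gmul P g h) = \<pi> g \<circ> \<pi> h) \<and>
       (\<forall>v. smooth_map_on (grp_atlas P) vector_atlas UNIV (\<lambda>g. \<pi> g v))"

definition assoc_rel ::
  "('p, 'ep, 'm, 'em, 'g, 'eg) pfb \<Rightarrow> ('g \<Rightarrow> 'v \<Rightarrow> 'v) \<Rightarrow> (('p \<times> 'v) \<times> ('p \<times> 'v)) set"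
  where
    "assoc_rel P \<pi> = {((u, v), (act P u g, \<pi> (ginv P g) v)) |u v g. True}"

text \<open>
  The associated bundle.  Its points are the classes \<open>[u, v]\<close> as subsets of \<open>P \<times> V\<close>; the set
  expressions for the fibrewise operations amount to \<open>[u, v] + [u, w] = [u, v + w]\<close>,
  \<open>c [u, v] = [u, c v]\<close>.  A local trivialisation \<open>(U, \<gamma>)\<close> of the principal bundle and a chart
  \<open>(W, \<phi>)\<close> of the base yield the chart \<open>[u, v] \<mapsto> (\<phi> (prj u), \<pi> (\<gamma> u) v)\<close> over \<open>U \<inter> W\<close>.
\<close>

definition assoc_proj :: "('p, 'ep, 'm, 'em, 'g, 'eg) pfb \<Rightarrow> ('p \<times> 'v) set \<Rightarrow> 'm"
  where "assoc_proj P c = the_elem ((\<lambda>(u, v). prj P u) ` c)"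

definition assoc_bundle ::
  "('p, 'ep::real_normed_vector, 'm::topological_space, 'em::real_normed_vector, 'g, 'eg::real_normed_vector) pfb \<Rightarrow>
   (complex \<Rightarrow> 'v \<Rightarrow> 'v::real_normed_vector) \<Rightarrow> ('g \<Rightarrow> 'v \<Rightarrow> 'v) \<Rightarrow>
   (('p \<times> 'v) set, 'm, 'em \<times> 'v) vbundle"
  where
    "assoc_bundle P sc \<pi> =
       \<lparr>vb_total = UNIV // assoc_rel P \<pi>,
        vb_proj = assoc_proj P,
        vb_atlas =
          {({c \<in> UNIV // assoc_rel P \<pi>. assoc_proj P c \<in> U \<inter> W},
            \<lambda>c. (\<phi> (assoc_proj P c), the_elem ((\<lambda>(u, v). \<pi> (\<gamma> u) v) ` c)))
           |U \<gamma> W \<phi>. local_triv P U \<gamma> \<and> (W, \<phi>) \<in> base_atlas P},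
        vb_add = (\<lambda>c d. {(u, v + w) |u v w. (u, v) \<in> c \<and> (u, w) \<in> d}),
        vb_zero = (\<lambda>x. {(u, 0) |u. prj P u = x}),
        vb_scale = (\<lambda>k c. {(u, sc k v) |u v. (u, v) \<in> c})\<rparr>"

section \<open>Invariant functions and the induced multiplication\<close>

text \<open>
  As \<open>V\<close> is finite dimensional, \<open>C\<^sup>\<infinity>(P) \<otimes> V\<close> is the space of smooth \<open>V\<close>-valued functions, with
  \<open>h \<otimes> w = (\<lambda>u. sc (h u) w)\<close>, and \<open>C\<^sup>\<infinity>(P)[[\<lambda>]] \<otimes> V\<close> is the space of formal series in it.
\<close>

definition vec_functions ::
  "('p, 'ep::real_normed_vector) atlas \<Rightarrow> (complex \<Rightarrow> 'v \<Rightarrow> 'v::real_normed_vector) \<Rightarrow> ('p \<Rightarrow> 'v) cspace"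
  where
    "vec_functions AP sc =
       \<lparr>carr = {F. smooth_map_on AP vector_atlas UNIV F},
        vadd = (\<lambda>F G u. F u + G u), vzero = (\<lambda>u. 0), vscale = (\<lambda>c F u. sc c (F u))\<rparr>"

definition invariants ::
  "('p, 'ep::real_normed_vector, 'm, 'em, 'g, 'eg) pfb \<Rightarrow>
   (complex \<Rightarrow> 'v \<Rightarrow> 'v::real_normed_vector) \<Rightarrow> ('g \<Rightarrow> 'v \<Rightarrow> 'v) \<Rightarrow> ('p \<Rightarrow> 'v) cspace"
  where
    "invariants P sc \<pi> =
       (vec_functions (tot_atlas P) sc)
         \<lparr>carr := {F \<in> carr (vec_functions (tot_atlas P) sc). \<forall>g. (\<lambda>u. \<pi> g (F (act P u g))) = F}\<rparr>"

definition tensor :: "(complex \<Rightarrow> 'v \<Rightarrow> 'v) \<Rightarrow> (nat \<Rightarrow> 'p \<Rightarrow> complex) \<Rightarrow> 'v \<Rightarrow> nat \<Rightarrow> 'p \<Rightarrow> 'v"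
  where "tensor sc h w = (\<lambda>n u. sc (h n u) w)"

text \<open>
  \<open>tm\<close> is the right multiplication on \<open>C\<^sup>\<infinity>(P)[[\<lambda>]] \<otimes> V\<close> that is additive in its first
  argument and given on elementary tensors by \<open>(h \<otimes> w) a = bul h a \<otimes> w\<close>; being additive, it is
  determined by these values.
\<close>

definition tensor_multiplication ::
  "('p, 'ep::real_normed_vector, 'm, 'em::real_normed_vector, 'g, 'eg) pfb \<Rightarrow>
   (complex \<Rightarrow> 'v \<Rightarrow> 'v::real_normed_vector) \<Rightarrow>
   ((nat \<Rightarrow> 'p \<Rightarrow> complex) \<Rightarrow> (nat \<Rightarrow> 'm \<Rightarrow> complex) \<Rightarrow> (nat \<Rightarrow> 'p \<Rightarrow> complex)) \<Rightarrow>
   ((nat \<Rightarrow> 'p \<Rightarrow> 'v) \<Rightarrow> (nat \<Rightarrow> 'm \<Rightarrow> complex) \<Rightarrow> (nat \<Rightarrow> 'p \<Rightarrow> 'v)) \<Rightarrow> bool"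
  where
    "tensor_multiplication P sc bul tm \<longleftrightarrow>
       (let CM = smooth_functions (base_atlas P); CP = smooth_functions (tot_atlas P);
            CPV = vec_functions (tot_atlas P) sc in
         (\<forall>F\<in>formal CPV. \<forall>G\<in>formal CPV. \<forall>a\<in>formal CM.
            tm (\<lambda>n u. F n u + G n u) a = (\<lambda>n u. tm F a n u + tm G a n u)) \<and>
         (\<forall>h\<in>formal CP. \<forall>w. \<forall>a\<in>formal CM. tm (tensor sc h w) a = tensor sc (bul h a) w))"

text \<open>
  The canonical isomorphism from sections of the associated bundle to invariant functions:
  \<open>s (prj u) = [u, section_to_fun s u]\<close>.
\<close>

definition section_to_fun ::
  "('p, 'ep, 'm, 'em, 'g, 'eg) pfb \<Rightarrow> ('g \<Rightarrow> 'v \<Rightarrow> 'v) \<Rightarrow> ('m \<Rightarrow> ('p \<times> 'v) set) \<Rightarrow> 'p \<Rightarrow> 'v"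
  where
    "section_to_fun P \<pi> s u = (THE v. s (prj P u) = assoc_rel P \<pi> `` {(u, v)})"

definition canonical_isomorphism ::
  "('p, 'ep::real_normed_vector, 'm::topological_space, 'em::real_normed_vector, 'g, 'eg::real_normed_vector) pfb \<Rightarrow>
   (complex \<Rightarrow> 'v \<Rightarrow> 'v::real_normed_vector) \<Rightarrow> ('g \<Rightarrow> 'v \<Rightarrow> 'v) \<Rightarrow> bool"
  where
    "canonical_isomorphism P sc \<pi> \<longleftrightarrow>
       (let E = assoc_bundle P sc \<pi>; \<Gamma> = smooth_sections (base_atlas P) E; I = invariants P sc \<pi> in
         bij_betw (section_to_fun P \<pi>) (carr \<Gamma>) (carr I) \<and>
         (\<forall>s\<in>carr \<Gamma>. \<forall>t\<in>carr \<Gamma>. section_to_fun P \<pi> (vadd \<Gamma> s t) =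
            vadd I (section_to_fun P \<pi> s) (section_to_fun P \<pi> t)) \<and>
         (\<forall>s\<in>carr \<Gamma>. \<forall>a\<in>carr (smooth_functions (base_atlas P)).
            section_to_fun P \<pi> (\<lambda>x. vb_scale E (a x) (s x)) =
              (\<lambda>u. sc (a (prj P u)) (section_to_fun P \<pi> s u))))"

definition transported_multiplication ::
  "('p, 'ep::real_normed_vector, 'm::topological_space, 'em::real_normed_vector, 'g, 'eg::real_normed_vector) pfb \<Rightarrow>
   (complex \<Rightarrow> 'v \<Rightarrow> 'v::real_normed_vector) \<Rightarrow> ('g \<Rightarrow> 'v \<Rightarrow> 'v) \<Rightarrow>
   ((nat \<Rightarrow> 'p \<Rightarrow> 'v) \<Rightarrow> (nat \<Rightarrow> 'm \<Rightarrow> complex) \<Rightarrow> (nat \<Rightarrow> 'p \<Rightarrow> 'v)) \<Rightarrow>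
   (nat \<Rightarrow> 'm \<Rightarrow> ('p \<times> 'v) set) \<Rightarrow> (nat \<Rightarrow> 'm \<Rightarrow> complex) \<Rightarrow> nat \<Rightarrow> 'm \<Rightarrow> ('p \<times> 'v) set"
  where
    "transported_multiplication P sc \<pi> tm s a n =
       inv_into (carr (smooth_sections (base_atlas P) (assoc_bundle P sc \<pi>))) (section_to_fun P \<pi>)
         (tm (\<lambda>m. section_to_fun P \<pi> (s m)) a n)"

end

(*
  In a basis of V the multiplication on V-valued functions is the given one applied to each
  coordinate, (sum_b f_b b) a = sum_b (f_b a) b.  An operator extended to V-valued functions in this
  way commutes with every linear map of V, so equivariance of the operators rho_r under the principal
  action turns into equivariance of their extensions, and invariant functions are preserved order by
  order.  An invariant function F corresponds to the section whose value at x is the graph of F over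
  the fibre of x; in a local trivialisation with section sigma this is F o sigma in one direction and
  u |-> pi(gamma(u)^-1) s(prj u) in the other, whence smoothness.
*)

theory Submission
  imports Defs
begin


text \<open>Equivariance is assumed for \<open>bul\<close> as a whole. It reaches each \<rho> r
  because, on series concentrated in order 0, the coefficient of order r of \<open>bul\<close> is
  \<rho> r itself. The module axioms are not checked order by order: the basis coordinates of a
  product are products under \<open>bul\<close>, so the axioms are inherited coordinate by
  coordinate. The same finite basis makes every V-valued series a finite sum of elementary tensors;
  this determines any admissible \<open>tm\<close> on formal series, while its values elsewhere stay
  arbitrary. Two obstacles shape the analytic half. Derivatives are controlled only in fixed
  directions, and likewise \<pi> is smooth only on fixed vectors; where the direction or the vector
  moves, it is expanded in a finite basis. Moreover, the total space of E comes with an atlas but no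
  topology, so smoothness of a section is settled directly in charts instead of by the composition
  lemmas.\<close>

section \<open>Calculus on finite-dimensional normed spaces\<close>

definition fin_dim :: "'a::real_normed_vector itself \<Rightarrow> bool"
  where "fin_dim _ \<longleftrightarrow> (\<exists>B::'a set. finite B \<and> span B = UNIV)"

lemma fin_dim_basis:
  assumes "fin_dim TYPE('a::real_normed_vector)"
  obtains B :: "'a::real_normed_vector set" where "finite B" "independent B" "span B = UNIV"
proof -
  obtain C :: "'a set" where C: "finite C" "span C = UNIV"
    using assms by (auto simp: fin_dim_def)
  obtain B where B: "B \<subseteq> C" "independent B" "C \<subseteq> span B"
    by (rule maximal_independent_subset[of C])
  have "span C \<subseteq> span B" using B(3) by (metis span_mono span_span)
  with C B show ?thesis by (intro that[of B]) (auto intro: finite_subset)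
qed

text \<open>The Euclidean versions of this fact do not apply, as no inner product is around; the
  coefficient norm is compared with the given one by compactness of its unit sphere.\<close>

lemma fin_dim_bounded_linear:
  fixes f :: "'a::real_normed_vector \<Rightarrow> 'b::real_normed_vector"
  assumes "fin_dim TYPE('a)" "linear f"
  shows "bounded_linear f"
proof -
  obtain B :: "'a set" where B: "finite B" "independent B" "span B = UNIV"
    using assms(1) by (rule fin_dim_basis)
  define g where "g = (\<lambda>a::'a \<Rightarrow> real. norm (\<Sum>b\<in>B. a b *\<^sub>R b))"
  define s where "s = (\<lambda>a::'a \<Rightarrow> real. \<Sum>b\<in>B. \<bar>a b\<bar>)"
  \<comment> \<open>A cube, compact by Tychonoff in the product topology. Coordinates off
    \<open>B\<close> are pinned to 0 so that every factor is compact.\<close>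
  define C where "C = PiE (UNIV::'a set) (\<lambda>b. if b \<in> B then {-1..1::real} else {0})"
  have cg: "continuous_on UNIV g" and cs: "continuous_on UNIV s"
    unfolding g_def s_def
    by (intro continuous_intros continuous_on_product_then_coordinatewise continuous_on_id)+
  have "compactin (product_topology (\<lambda>i::'a. euclideanreal) UNIV) C"
    unfolding C_def compactin_PiE by auto
  then have "compact C" by (simp add: euclidean_product_topology)
  moreover have "closed (s -` {1})"
    using cs by (intro closed_vimage) auto
  ultimately have compK: "compact (C \<inter> s -` {1})" by (rule compact_Int_closed)
  \<comment> \<open>Dividing by \<open>s a\<close> puts the coefficients on the unit sphere of
    \<open>s\<close> inside the cube, and \<open>g\<close> scales along; off \<open>B\<close> the
    value is reset to 0 in order to land in \<open>C\<close>.\<close>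
  have normalise: "s a > 0 \<and> (\<exists>a'\<in>C \<inter> s -` {1}. g a' = g a / s a)" if "s a \<noteq> 0" for a
  proof -
    have sp: "s a > 0"
      using that by (simp add: s_def sum_nonneg order.not_eq_order_implies_strict)
    define a' where "a' = (\<lambda>b. if b \<in> B then a b / s a else 0)"
    have "\<bar>a b\<bar> \<le> s a" if "b \<in> B" for b
      unfolding s_def using B(1) that by (intro member_le_sum) auto
    then have "a' \<in> C"
      using sp by (auto simp: C_def a'_def abs_le_iff minus_le_iff divide_simps)
    moreover have "s a' = s a / s a"
      using sp by (simp add: s_def a'_def abs_divide flip: sum_divide_distrib)
    moreover have "(\<Sum>b\<in>B. a' b *\<^sub>R b) = (1 / s a) *\<^sub>R (\<Sum>b\<in>B. a b *\<^sub>R b)"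
      by (simp add: a'_def scaleR_sum_right)
    then have "g a' = g a / s a" using sp by (simp add: g_def)
    ultimately show ?thesis using sp by auto
  qed
  have "\<exists>c>0. \<forall>a. c * s a \<le> g a"
  proof (cases "C \<inter> s -` {1} = {}")
    case False
    obtain a0 where a0: "a0 \<in> C" "s a0 = 1" and min: "\<forall>a\<in>C \<inter> s -` {1}. g a0 \<le> g a"
      using continuous_attains_inf[OF compK False continuous_on_subset[OF cg]] by auto
    \<comment> \<open>Independence of \<open>B\<close> keeps the minimum of \<open>g\<close> on the
      sphere away from 0; this minimum is the constant of comparison.\<close>
    have "g a0 \<noteq> 0"
    proof
      assume "g a0 = 0"
      then have "\<forall>b\<in>B. a0 b = 0"
        using B(1,2) unfolding g_def by (auto dest: independentD)
      then show False using a0(2) by (simp add: s_def)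
    qed
    then have "g a0 > 0" by (simp add: g_def order.not_eq_order_implies_strict)
    moreover have "g a0 * s a \<le> g a" for a
    proof (cases "s a = 0")
      case True then show ?thesis by (simp add: g_def)
    next
      case False
      with normalise min have "s a > 0" "g a0 \<le> g a / s a" by metis+
      then show ?thesis by (simp add: field_simps)
    qed
    ultimately show ?thesis by blast
  next
    \<comment> \<open>An empty sphere means that \<open>s\<close> vanishes identically, which is
      dimension 0; any positive constant serves.\<close>
    case True
    then have "s a = 0" for a using normalise by blast
    then show ?thesis by (intro exI[of _ 1]) (simp add: g_def)
  qed
  then obtain c where c: "c > 0" "\<And>a. c * s a \<le> g a" by auto
  define M where "M = (\<Sum>b\<in>B. norm (f b))"
  show ?thesis
  proof (rule bounded_linear_intro[where K = "M / c"])
    fix x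
    have "x \<in> span B" using B(3) by simp
    then obtain a where x: "x = (\<Sum>b\<in>B. a b *\<^sub>R b)"
      unfolding span_finite[OF B(1)] by auto
    have "f x = (\<Sum>b\<in>B. a b *\<^sub>R f b)"
      using assms(2) by (simp add: x linear_sum linear_scale)
    also have "norm \<dots> \<le> (\<Sum>b\<in>B. \<bar>a b\<bar> * norm (f b))"
      by (rule order_trans[OF norm_sum]) simp
    also have "\<dots> \<le> (\<Sum>b\<in>B. \<bar>a b\<bar> * M)"
      unfolding M_def using B(1) by (intro sum_mono mult_left_mono member_le_sum) auto
    also have "\<dots> = s a * M" by (simp add: s_def sum_distrib_right)
    also have "\<dots> \<le> (g a / c) * M"
      using c by (intro mult_right_mono) (auto simp: M_def field_simps sum_nonneg)
    finally show "norm (f x) \<le> norm x * (M / c)" by (simp add: g_def x)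
  qed (use assms(2) in \<open>auto simp: linear_add linear_scale\<close>)
qed

section \<open>Iterated differentiability: locality, Leibniz rule, chain rule\<close>

text \<open>A derivative sees only a neighbourhood of the point, hence the open set. In the rules
  below this lemma replaces the derivative of a composite by its explicit formula.\<close>

lemma times_diff_cong:
  assumes "open S" "\<And>x. x \<in> S \<Longrightarrow> f x = g x"
  shows "times_diff n S f \<longleftrightarrow> times_diff n S g"
proof -
  have "times_diff n S g"
    if "times_diff n S f" "\<And>x. x \<in> S \<Longrightarrow> f x = g x" for f g :: "'a \<Rightarrow> 'b"
    using that
  proof (induction n arbitrary: f g)
    case 0 then show ?case by (auto cong: continuous_on_cong)
  next
    case (Suc n)
    have d: "frechet_derivative f (at x) = frechet_derivative g (at x)" "g differentiable at x"
      if "x \<in> S" for x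
    proof -
      have "f differentiable at x" using Suc.prems(1) that by simp
      then show "frechet_derivative f (at x) = frechet_derivative g (at x)"
        by (rule frechet_derivative_transform_within_open[OF _ assms(1) that Suc.prems(2)])
      from \<open>f differentiable at x\<close> obtain D where "(f has_derivative D) (at x)"
        by (auto simp: differentiable_def)
      then have "(g has_derivative D) (at x)"
        by (rule has_derivative_transform_within_open[OF _ assms(1) that Suc.prems(2)])
      then show "g differentiable at x" by (rule differentiableI)
    qed
    have "times_diff n S (\<lambda>x. frechet_derivative g (at x) v)" for v
    proof (rule Suc.IH)
      show "times_diff n S (\<lambda>x. frechet_derivative f (at x) v)" using Suc.prems(1) by simp
    qed (metis d(1))
    then show ?case using d by simp
  qed
  from this[of f g] this[of g f] assms show ?thesis by auto
qed

lemma times_diff_subset: "times_diff n S f \<Longrightarrow> T \<subseteq> S \<Longrightarrow> times_diff n T f"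
  by (induction n arbitrary: f) (auto intro: continuous_on_subset)

text \<open>Differentiability supplies the continuity at the bottom of the recursion. The product
  and chain rules use this for the factors that are left undifferentiated.\<close>

lemma times_diff_Suc_imp: "times_diff (Suc n) S f \<Longrightarrow> times_diff n S f"
proof (induction n arbitrary: f)
  case 0 then show ?case
    by (auto intro!: continuous_at_imp_continuous_on differentiable_imp_continuous_within)
next
  case (Suc n) then show ?case by (metis times_diff.simps(2))
qed

text \<open>Allows coordinate expressions to be rewritten on neighbourhoods that vary with the
  point.\<close>

lemma times_diff_locally:
  assumes "\<And>x. x \<in> S \<Longrightarrow> \<exists>T. open T \<and> x \<in> T \<and> times_diff n T f"
  shows "times_diff n S f"
  using assms
proof (induction n arbitrary: f)
  case 0
  then show ?case
    by (fastforce intro!: continuous_at_imp_continuous_on simp: continuous_on_eq_continuous_at)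
next
  case (Suc n)
  have "times_diff n S (\<lambda>x. frechet_derivative f (at x) v)" for v
    using Suc.prems by (intro Suc.IH) fastforce
  then show ?case using Suc.prems by fastforce
qed

lemma times_diff_const: "times_diff n S (\<lambda>x. c)"
  by (induction n arbitrary: c) auto

lemma times_diff_linear:
  assumes "open S" "bounded_linear L" "times_diff n S f"
  shows "times_diff n S (\<lambda>x. L (f x))"
  using assms(3)
proof (induction n arbitrary: f)
  case 0 then show ?case
    using assms(2) by (auto intro: bounded_linear.continuous_on)
next
  case (Suc n)
  have d: "((\<lambda>x. L (f x)) has_derivative (\<lambda>v. L (frechet_derivative f (at x) v))) (at x)"
    if "x \<in> S" for x
    using Suc.prems that
    by (intro bounded_linear.has_derivative[OF assms(2)]) (auto simp: frechet_derivative_works)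
  have "times_diff n S (\<lambda>x. frechet_derivative (\<lambda>x. L (f x)) (at x) v)" for v
    using Suc by (subst times_diff_cong[OF assms(1) fun_cong[OF frechet_derivative_at[OF d], symmetric]]) auto
  then show ?case using d by (auto intro: differentiableI)
qed

lemma times_diff_add:
  assumes "open S" "times_diff n S f" "times_diff n S g"
  shows "times_diff n S (\<lambda>x. f x + g x)"
  using assms(2,3)
proof (induction n arbitrary: f g)
  case 0 then show ?case by (auto intro: continuous_on_add)
next
  case (Suc n)
  have d: "((\<lambda>x. f x + g x) has_derivative
      (\<lambda>v. frechet_derivative f (at x) v + frechet_derivative g (at x) v)) (at x)"
    if "x \<in> S" for x
    using Suc.prems that by (intro has_derivative_add) (auto simp: frechet_derivative_works)
  have "times_diff n S (\<lambda>x. frechet_derivative (\<lambda>x. f x + g x) (at x) v)" for v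
    using Suc by (subst times_diff_cong[OF assms(1) fun_cong[OF frechet_derivative_at[OF d], symmetric]]) auto
  then show ?case using d by (auto intro: differentiableI)
qed

lemma times_diff_sum:
  assumes "open S" "\<And>i. i \<in> I \<Longrightarrow> times_diff n S (f i)"
  shows "times_diff n S (\<lambda>x. \<Sum>i\<in>I. f i x)"
  using assms(2)
  by (induction I rule: infinite_finite_induct) (auto intro: times_diff_add[OF assms(1)] times_diff_const)

text \<open>By the Leibniz rule the derivative is a sum of two terms of the same bilinear shape, so
  the induction runs over all pairs \<open>f\<close>, \<open>g\<close>.\<close>

lemma times_diff_bilinear:
  assumes "open S" "bounded_bilinear h" "times_diff n S f" "times_diff n S g"
  shows "times_diff n S (\<lambda>x. h (f x) (g x))"
  using assms(3,4)
proof (induction n arbitrary: f g)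
  case 0 then show ?case
    using assms(2) by (auto intro: bounded_bilinear.continuous_on)
next
  case (Suc n)
  have d: "((\<lambda>x. h (f x) (g x)) has_derivative
      (\<lambda>v. h (f x) (frechet_derivative g (at x) v) + h (frechet_derivative f (at x) v) (g x))) (at x)"
    if "x \<in> S" for x
    using Suc.prems that
    by (intro bounded_bilinear.FDERIV[OF assms(2)]) (auto simp: frechet_derivative_works)
  have "times_diff n S (\<lambda>x. frechet_derivative (\<lambda>x. h (f x) (g x)) (at x) v)" for v
  proof (subst times_diff_cong[OF assms(1) fun_cong[OF frechet_derivative_at[OF d], symmetric]])
    show "times_diff n S (\<lambda>x. h (f x) (frechet_derivative g (at x) v) +
        h (frechet_derivative f (at x) v) (g x))"
      using Suc.prems times_diff_Suc_imp[OF Suc.prems(1)] times_diff_Suc_imp[OF Suc.prems(2)]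
      by (intro times_diff_add[OF assms(1)] Suc.IH) simp_all
  qed
  then show ?case using d by (auto intro: differentiableI)
qed

text \<open>The chain rule differentiates g at f x in the direction f'(x) v, which moves with x,
  whereas \<open>times_diff\<close> controls fixed directions. A finite basis of the middle space
  turns this into coefficients times derivatives of \<open>g\<close> in basis directions, to which
  the product rule and the induction apply.\<close>

lemma times_diff_compose:
  fixes f :: "'a::real_normed_vector \<Rightarrow> 'b::real_normed_vector"
    and g :: "'b \<Rightarrow> 'c::real_normed_vector"
  assumes fd: "fin_dim TYPE('b)" and "open S" "open T" "f ` S \<subseteq> T"
    and "times_diff n S f" "times_diff n T g"
  shows "times_diff n S (\<lambda>x. g (f x))"
  using assms(5,6)
proof (induction n arbitrary: g)
  case 0 then show ?case
    by (simp add: continuous_on_compose2[OF _ _ assms(4)])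
next
  case (Suc n)
  obtain B :: "'b set" where B: "finite B" "independent B" "span B = UNIV"
    using fd by (rule fin_dim_basis)
  \<comment> \<open>Coordinate functionals of the basis, bounded because the dimension is
    finite.\<close>
  define co where "co = (\<lambda>b w. representation B w b)"
  have lin: "bounded_linear (co b)" for b
    unfolding co_def using B
    by (intro fin_dim_bounded_linear[OF fd] linearI) (auto simp: representation_add representation_scale)
  have d: "((\<lambda>x. g (f x)) has_derivative
      (\<lambda>v. \<Sum>b\<in>B. co b (frechet_derivative f (at x) v) *\<^sub>R frechet_derivative g (at (f x)) b)) (at x)"
    if "x \<in> S" for x
  proof -
    have gd: "(g has_derivative frechet_derivative g (at (f x))) (at (f x))"
      using Suc.prems that assms(4) by (auto simp: frechet_derivative_works)
    then have l: "linear (frechet_derivative g (at (f x)))" by (rule has_derivative_linear)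
    have expand: "frechet_derivative g (at (f x)) w =
       (\<Sum>b\<in>B. co b w *\<^sub>R frechet_derivative g (at (f x)) b)" for w
    proof -
      have "w = (\<Sum>b\<in>B. co b w *\<^sub>R b)"
        unfolding co_def using B by (simp add: real_vector.sum_representation_eq)
      then have "frechet_derivative g (at (f x)) w = frechet_derivative g (at (f x)) \<dots>" by simp
      also have "\<dots> = (\<Sum>b\<in>B. co b w *\<^sub>R frechet_derivative g (at (f x)) b)"
        using l by (simp add: linear_sum linear_scale)
      finally show ?thesis .
    qed
    have "(f has_derivative frechet_derivative f (at x)) (at x)"
      using Suc.prems that by (auto simp: frechet_derivative_works)
    then have *: "((\<lambda>x. g (f x)) has_derivative
        (\<lambda>v. frechet_derivative g (at (f x)) (frechet_derivative f (at x) v))) (at x)"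
      using gd by (rule has_derivative_compose)
    show ?thesis
      by (rule has_derivative_eq_rhs[OF *]) (rule ext, rule expand)
  qed
  have "times_diff n S (\<lambda>x. \<Sum>b\<in>B. co b (frechet_derivative f (at x) v) *\<^sub>R frechet_derivative g (at (f x)) b)" for v
  proof (intro times_diff_sum times_diff_bilinear[OF _ bounded_bilinear_scaleR] times_diff_linear[OF _ lin] assms(2))
    show "times_diff n S (\<lambda>x. frechet_derivative f (at x) v)" using Suc.prems by simp
    show "times_diff n S (\<lambda>x. frechet_derivative g (at (f x)) b)" for b
      by (rule Suc.IH) (use Suc.prems times_diff_Suc_imp in auto)
  qed
  then have "times_diff n S (\<lambda>x. frechet_derivative (\<lambda>x. g (f x)) (at x) v)" for v
    by (subst times_diff_cong[OF assms(2) fun_cong[OF frechet_derivative_at[OF d], symmetric]]) auto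
  then show ?case using d by (auto intro: differentiableI)
qed

section \<open>Smooth functions on open subsets of model spaces\<close>

lemma smooth_on_cong:
  "open S \<Longrightarrow> (\<And>x. x \<in> S \<Longrightarrow> f x = g x) \<Longrightarrow> smooth_on S f \<longleftrightarrow> smooth_on S g"
  unfolding smooth_on_def by (metis times_diff_cong)

lemma smooth_on_subset: "smooth_on S f \<Longrightarrow> T \<subseteq> S \<Longrightarrow> smooth_on T f"
  unfolding smooth_on_def using times_diff_subset by blast

lemma smooth_on_imp_continuous_on: "smooth_on S f \<Longrightarrow> continuous_on S f"
  unfolding smooth_on_def by (metis times_diff.simps(1))

lemma smooth_on_locally:
  "(\<And>x. x \<in> S \<Longrightarrow> \<exists>T. open T \<and> x \<in> T \<and> smooth_on T f) \<Longrightarrow> smooth_on S f"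
  unfolding smooth_on_def by (metis times_diff_locally)

lemma smooth_on_const: "smooth_on S (\<lambda>x. c)"
  by (simp add: smooth_on_def times_diff_const)

lemma smooth_on_linear:
  "open S \<Longrightarrow> bounded_linear L \<Longrightarrow> smooth_on S f \<Longrightarrow> smooth_on S (\<lambda>x. L (f x))"
  unfolding smooth_on_def by (metis times_diff_linear)

lemma smooth_on_add:
  "open S \<Longrightarrow> smooth_on S f \<Longrightarrow> smooth_on S g \<Longrightarrow> smooth_on S (\<lambda>x. f x + g x)"
  unfolding smooth_on_def by (metis times_diff_add)

lemma smooth_on_bilinear:
  "open S \<Longrightarrow> bounded_bilinear h \<Longrightarrow> smooth_on S f \<Longrightarrow> smooth_on S g \<Longrightarrow>
    smooth_on S (\<lambda>x. h (f x) (g x))"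
  unfolding smooth_on_def by (metis times_diff_bilinear)

lemma smooth_on_compose:
  fixes f :: "'a::real_normed_vector \<Rightarrow> 'b::real_normed_vector"
  assumes "fin_dim TYPE('b)" "open S" "open T" "f ` S \<subseteq> T" "smooth_on S f" "smooth_on T g"
  shows "smooth_on S (\<lambda>x. g (f x))"
  using assms times_diff_compose unfolding smooth_on_def by metis

lemma smooth_on_ident: "smooth_on S (\<lambda>x. x)"
  unfolding smooth_on_def
proof
  show "times_diff n S (\<lambda>x. x)" for n
    by (cases n) (auto simp: times_diff_const)
qed

text \<open>The pair is the sum of its components under the two linear inclusions of the
  factors.\<close>

lemma smooth_on_Pair:
  assumes "open S" "smooth_on S f" "smooth_on S g"
  shows "smooth_on S (\<lambda>x. (f x, g x))"
proof -
  have "bounded_linear (\<lambda>y. (y, 0))" "bounded_linear (\<lambda>y. (0, y))"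
    by (auto intro!: bounded_linear_Pair bounded_linear_ident bounded_linear_zero)
  from smooth_on_add[OF assms(1) smooth_on_linear[OF assms(1) this(1) assms(2)]
      smooth_on_linear[OF assms(1) this(2) assms(3)]]
  show ?thesis by simp
qed


section \<open>Smooth maps between manifolds\<close>

text \<open>The conditions of \<^const>\<open>smooth_manifold\<close> without its sort constraint, so that model spaces
  (which need not be of class \<^class>\<open>second_countable_topology\<close>) are covered as well.\<close>

definition smooth_atlas :: "('a::t2_space, 'e::real_normed_vector) atlas \<Rightarrow> bool"
  where
    "smooth_atlas A \<longleftrightarrow> fin_dim TYPE('e) \<and>
       (\<forall>(U, \<phi>) \<in> A. open U \<and> open (\<phi> ` U) \<and> homeomorphism U (\<phi> ` U) \<phi> (inv_into U \<phi>)) \<and>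
       (\<Union>(U, \<phi>) \<in> A. U) = UNIV \<and>
       (\<forall>(U, \<phi>) \<in> A. \<forall>(V, \<psi>) \<in> A. smooth_on (\<phi> ` (U \<inter> V)) (\<psi> \<circ> inv_into U \<phi>))"

lemma smooth_manifold_imp_smooth_atlas: "smooth_manifold A \<Longrightarrow> smooth_atlas A"
  unfolding smooth_manifold_def smooth_atlas_def fin_dim_def by (rule conjI; elim conjE; assumption?; intro conjI; assumption)

lemma smooth_atlas_fin_dim:
  "smooth_atlas (A :: ('a::t2_space, 'e::real_normed_vector) atlas) \<Longrightarrow> fin_dim TYPE('e)"
  by (simp add: smooth_atlas_def)

section \<open>Charts and the topology of the manifold\<close>

lemma chart_homeomorphism:
  "smooth_atlas A \<Longrightarrow> (U, \<phi>) \<in> A \<Longrightarrow>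
    open U \<and> open (\<phi> ` U) \<and> homeomorphism U (\<phi> ` U) \<phi> (inv_into U \<phi>)"
  by (auto simp: smooth_atlas_def)

lemma chart_open: "smooth_atlas A \<Longrightarrow> (U, \<phi>) \<in> A \<Longrightarrow> open U"
  using chart_homeomorphism by blast

lemma chart_inv [simp]:
  "smooth_atlas A \<Longrightarrow> (U, \<phi>) \<in> A \<Longrightarrow> x \<in> U \<Longrightarrow> inv_into U \<phi> (\<phi> x) = x"
  using chart_homeomorphism homeomorphism_apply1 by metis

lemma chart_inj_on: "smooth_atlas A \<Longrightarrow> (U, \<phi>) \<in> A \<Longrightarrow> inj_on \<phi> U"
  by (rule inj_on_inverseI) (rule chart_inv)

lemma chart_image_open:
  assumes "smooth_atlas A" "(U, \<phi>) \<in> A" "open W" "W \<subseteq> U"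
  shows "open (\<phi> ` W)"
proof -
  note h = chart_homeomorphism[OF assms(1,2)]
  have "openin (top_of_set (\<phi> ` U)) (\<phi> ` W)"
    using h assms(3,4) by (intro homeomorphism_imp_open_map[of U _ _ "inv_into U \<phi>"]) (auto simp: openin_open_eq)
  then show ?thesis using h openin_open_trans by blast
qed

text \<open>\<open>smooth_map_on\<close> records openness only inside a chart; this brings it back
  to the topology of the manifold.\<close>

lemma chart_preimage_open:
  assumes "smooth_atlas A" "(U, \<phi>) \<in> A" "open (\<phi> ` W)" "W \<subseteq> U"
  shows "open W"
proof -
  note h = chart_homeomorphism[OF assms(1,2)]
  have "openin (top_of_set U) (inv_into U \<phi> ` \<phi> ` W)"
  proof (rule homeomorphism_imp_open_map)
    show "homeomorphism (\<phi> ` U) U (inv_into U \<phi>) \<phi>" using h homeomorphism_symD by blast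
    show "openin (top_of_set (\<phi> ` U)) (\<phi> ` W)" using h assms(3,4) by (auto simp: openin_open_eq)
  qed
  moreover have "inv_into U \<phi> ` \<phi> ` W = W"
    using assms chart_inj_on by (metis inv_into_image_cancel)
  ultimately show ?thesis using h openin_open_trans by metis
qed

lemma chart_exists:
  assumes "smooth_atlas A"
  obtains U \<phi> where "(U, \<phi>) \<in> A" "x \<in> U"
  using assms unfolding smooth_atlas_def by blast

lemma chart_transition:
  "smooth_atlas A \<Longrightarrow> (U, \<phi>) \<in> A \<Longrightarrow> (V, \<psi>) \<in> A \<Longrightarrow> smooth_on (\<phi> ` (U \<inter> V)) (\<psi> \<circ> inv_into U \<phi>)"
  by (auto simp: smooth_atlas_def)

section \<open>Smooth maps: restriction, continuity, change of charts, composition\<close>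

lemma smooth_map_onE:
  assumes "smooth_map_on A B S f" "x \<in> S"
  obtains U \<phi> V \<psi> W where "(U, \<phi>) \<in> A" "(V, \<psi>) \<in> B" "x \<in> W" "W \<subseteq> U" "W \<subseteq> S"
    "open (\<phi> ` W)" "f ` W \<subseteq> V" "smooth_on (\<phi> ` W) (\<psi> \<circ> f \<circ> inv_into U \<phi>)"
proof -
  from bspec[OF assms(1)[unfolded smooth_map_on_def] assms(2)]
  obtain p q W where "p \<in> A" "q \<in> B" "x \<in> W" "W \<subseteq> fst p \<inter> S" "open (snd p ` W)" "f ` W \<subseteq> fst q"
    "smooth_on (snd p ` W) (snd q \<circ> f \<circ> inv_into (fst p) (snd p))"
    unfolding case_prod_unfold by blast
  then show ?thesis using that[of "fst p" "snd p" "fst q" "snd q" W] by simp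
qed

lemma smooth_map_on_witness:
  assumes "(U, \<phi>) \<in> A" "(V, \<psi>) \<in> B" "x \<in> W" "W \<subseteq> U" "W \<subseteq> S"
    "open (\<phi> ` W)" "f ` W \<subseteq> V" "smooth_on (\<phi> ` W) (\<psi> \<circ> f \<circ> inv_into U \<phi>)"
  shows "\<exists>U \<phi> V \<psi> W. (U, \<phi>) \<in> A \<and> (V, \<psi>) \<in> B \<and> x \<in> W \<and> W \<subseteq> U \<and> W \<subseteq> S \<and>
    open (\<phi> ` W) \<and> f ` W \<subseteq> V \<and> smooth_on (\<phi> ` W) (\<psi> \<circ> f \<circ> inv_into U \<phi>)"
  using assms by (intro exI conjI)

lemma smooth_map_onI:
  assumes "\<And>x. x \<in> S \<Longrightarrow> \<exists>U \<phi> V \<psi> W. (U, \<phi>) \<in> A \<and> (V, \<psi>) \<in> B \<and> x \<in> W \<and> W \<subseteq> U \<and> W \<subseteq> S \<and>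
    open (\<phi> ` W) \<and> f ` W \<subseteq> V \<and> smooth_on (\<phi> ` W) (\<psi> \<circ> f \<circ> inv_into U \<phi>)"
  shows "smooth_map_on A B S f"
  unfolding smooth_map_on_def
proof
  fix x assume "x \<in> S"
  from assms[OF this] obtain U \<phi> V \<psi> W where *: "(U, \<phi>) \<in> A" "(V, \<psi>) \<in> B" "x \<in> W" "W \<subseteq> U" "W \<subseteq> S"
    "open (\<phi> ` W)" "f ` W \<subseteq> V" "smooth_on (\<phi> ` W) (\<psi> \<circ> f \<circ> inv_into U \<phi>)"
    by blast
  show "\<exists>(U, \<phi>)\<in>A. \<exists>(V, \<psi>)\<in>B. \<exists>W. x \<in> W \<and> W \<subseteq> U \<inter> S \<and> open (\<phi> ` W) \<and> f ` W \<subseteq> V \<and>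
      smooth_on (\<phi> ` W) (\<psi> \<circ> f \<circ> inv_into U \<phi>)"
    by (rule bexI[OF _ *(1)], clarify, rule bexI[OF _ *(2)], clarify, rule exI[of _ W])
      (use * in blast)
qed

text \<open>The witnesses around the points are open and lie in \<open>S\<close>, so smoothness
  carries openness of its domain along.\<close>

lemma smooth_map_on_open:
  assumes "smooth_atlas A" "smooth_map_on A B S f"
  shows "open S"
proof (rule Topological_Spaces.openI)
  fix x assume "x \<in> S"
  with assms(2) show "\<exists>T. open T \<and> x \<in> T \<and> T \<subseteq> S"
    by (rule smooth_map_onE) (use chart_preimage_open[OF assms(1)] in metis)
qed

lemma smooth_map_on_locally:
  assumes "\<And>x. x \<in> S \<Longrightarrow> \<exists>T. x \<in> T \<and> T \<subseteq> S \<and> smooth_map_on A B T f"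
  shows "smooth_map_on A B S f"
proof (rule smooth_map_onI)
  fix x assume "x \<in> S"
  then obtain T where T: "x \<in> T" "T \<subseteq> S" "smooth_map_on A B T f" using assms by blast
  from T(3,1) obtain U \<phi> V \<psi> W where *: "(U, \<phi>) \<in> A" "(V, \<psi>) \<in> B" "x \<in> W" "W \<subseteq> U" "W \<subseteq> T"
    "open (\<phi> ` W)" "f ` W \<subseteq> V" "smooth_on (\<phi> ` W) (\<psi> \<circ> f \<circ> inv_into U \<phi>)"
    by (rule smooth_map_onE)
  show "\<exists>U \<phi> V \<psi> W. (U, \<phi>) \<in> A \<and> (V, \<psi>) \<in> B \<and> x \<in> W \<and> W \<subseteq> U \<and> W \<subseteq> S \<and>
    open (\<phi> ` W) \<and> f ` W \<subseteq> V \<and> smooth_on (\<phi> ` W) (\<psi> \<circ> f \<circ> inv_into U \<phi>)"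
    by (rule smooth_map_on_witness[OF *(1-4) order_trans[OF *(5) T(2)] *(6-8)])
qed

lemma smooth_map_on_cong:
  assumes A: "smooth_atlas A" and "smooth_map_on A B S f" and eq: "\<And>x. x \<in> S \<Longrightarrow> f x = g x"
  shows "smooth_map_on A B S g"
proof (rule smooth_map_onI)
  fix x assume "x \<in> S"
  with assms(2) obtain U \<phi> V \<psi> W where *: "(U, \<phi>) \<in> A" "(V, \<psi>) \<in> B" "x \<in> W" "W \<subseteq> U" "W \<subseteq> S"
    "open (\<phi> ` W)" "f ` W \<subseteq> V" "smooth_on (\<phi> ` W) (\<psi> \<circ> f \<circ> inv_into U \<phi>)"
    by (rule smooth_map_onE)
  have "smooth_on (\<phi> ` W) (\<psi> \<circ> g \<circ> inv_into U \<phi>)"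
  proof (subst smooth_on_cong[OF *(6), symmetric])
    show "smooth_on (\<phi> ` W) (\<psi> \<circ> f \<circ> inv_into U \<phi>)" by fact
    show "(\<psi> \<circ> f \<circ> inv_into U \<phi>) y = (\<psi> \<circ> g \<circ> inv_into U \<phi>) y" if "y \<in> \<phi> ` W" for y
      using that *(4,5) chart_inv[OF A *(1)] eq by (auto simp: subset_iff)
  qed
  moreover have "g ` W \<subseteq> V" using *(5,7) eq by force
  ultimately show "\<exists>U \<phi> V \<psi> W. (U, \<phi>) \<in> A \<and> (V, \<psi>) \<in> B \<and> x \<in> W \<and> W \<subseteq> U \<and> W \<subseteq> S \<and>
    open (\<phi> ` W) \<and> g ` W \<subseteq> V \<and> smooth_on (\<phi> ` W) (\<psi> \<circ> g \<circ> inv_into U \<phi>)"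
    using * by blast
qed

lemma smooth_map_on_subset:
  assumes A: "smooth_atlas A" and "smooth_map_on A B S f" "open T" "T \<subseteq> S"
  shows "smooth_map_on A B T f"
proof (rule smooth_map_onI)
  fix x assume x: "x \<in> T"
  then have "x \<in> S" using assms by blast
  with assms(2) obtain U \<phi> V \<psi> W where *: "(U, \<phi>) \<in> A" "(V, \<psi>) \<in> B" "x \<in> W" "W \<subseteq> U" "W \<subseteq> S"
    "open (\<phi> ` W)" "f ` W \<subseteq> V" "smooth_on (\<phi> ` W) (\<psi> \<circ> f \<circ> inv_into U \<phi>)"
    by (rule smooth_map_onE)
  have "open (\<phi> ` (W \<inter> T))"
    using chart_preimage_open[OF A *(1,6,4)] assms(3) *(4)
    by (intro chart_image_open[OF A *(1)]) auto
  moreover have "smooth_on (\<phi> ` (W \<inter> T)) (\<psi> \<circ> f \<circ> inv_into U \<phi>)"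
    using *(8) by (rule smooth_on_subset) auto
  ultimately show "\<exists>U \<phi> V \<psi> W. (U, \<phi>) \<in> A \<and> (V, \<psi>) \<in> B \<and> x \<in> W \<and> W \<subseteq> U \<and> W \<subseteq> T \<and>
    open (\<phi> ` W) \<and> f ` W \<subseteq> V \<and> smooth_on (\<phi> ` W) (\<psi> \<circ> f \<circ> inv_into U \<phi>)"
    using *(3-7) x by (intro smooth_map_on_witness[OF *(1,2), of _ "W \<inter> T"]) auto
qed

text \<open>Near a point the map is a chart, followed by a smooth expression, followed by an inverse
  chart.\<close>

lemma smooth_map_on_continuous:
  assumes A: "smooth_atlas A" and B: "smooth_atlas B" and f: "smooth_map_on A B S f"
  shows "continuous_on S f"
proof -
  have "isCont f x" if "x \<in> S" for x
  proof -
    from f that obtain U \<phi> V \<psi> W where *: "(U, \<phi>) \<in> A" "(V, \<psi>) \<in> B" "x \<in> W" "W \<subseteq> U" "W \<subseteq> S"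
      "open (\<phi> ` W)" "f ` W \<subseteq> V" "smooth_on (\<phi> ` W) (\<psi> \<circ> f \<circ> inv_into U \<phi>)"
      by (rule smooth_map_onE)
    note hA = chart_homeomorphism[OF A *(1)] and hB = chart_homeomorphism[OF B *(2)]
    have "continuous_on W (\<lambda>x. inv_into V \<psi> ((\<psi> \<circ> f \<circ> inv_into U \<phi>) (\<phi> x)))"
    proof (rule continuous_on_compose2[of "\<psi> ` V" "inv_into V \<psi>"])
      show "continuous_on (\<psi> ` V) (inv_into V \<psi>)" using hB homeomorphism_cont2 by blast
      show "continuous_on W (\<lambda>x. (\<psi> \<circ> f \<circ> inv_into U \<phi>) (\<phi> x))"
        using *(4) hA
        by (intro continuous_on_compose2[OF smooth_on_imp_continuous_on[OF *(8)]])
          (auto intro: continuous_on_subset homeomorphism_cont1)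
      show "(\<lambda>x. (\<psi> \<circ> f \<circ> inv_into U \<phi>) (\<phi> x)) ` W \<subseteq> \<psi> ` V"
        using *(4,7) chart_inv[OF A *(1)] by (auto simp: subset_iff)
    qed
    moreover have "inv_into V \<psi> ((\<psi> \<circ> f \<circ> inv_into U \<phi>) (\<phi> x)) = f x" if "x \<in> W" for x
      using that *(4,7) chart_inv[OF A *(1)] chart_inv[OF B *(2)] by (auto simp: subset_iff)
    ultimately have "continuous_on W f" by (simp cong: continuous_on_cong)
    moreover have "open W" using chart_preimage_open[OF A *(1,6,4)] .
    ultimately show ?thesis using *(3) by (simp add: continuous_on_eq_continuous_at)
  qed
  then show ?thesis by (simp add: continuous_at_imp_continuous_on)
qed

lemma smooth_map_on_preimage_open:
  assumes A: "smooth_atlas A" and B: "smooth_atlas B" and f: "smooth_map_on A B S f"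
    and T: "open T"
  shows "open (S \<inter> f -` T)"
  using smooth_map_on_continuous[OF A B f] smooth_map_on_open[OF A f] T
  by (rule continuous_open_preimage)

text \<open>The definition offers some pair of charts at each point. Any other pair differs from it
  by transition maps, so locally the expression is the given one composed with a transition on
  either side.\<close>

lemma smooth_map_on_charts:
  fixes A :: "('a::t2_space, 'e::real_normed_vector) atlas"
    and B :: "('b::t2_space, 'f::real_normed_vector) atlas"
  assumes A: "smooth_atlas A" and B: "smooth_atlas B" and f: "smooth_map_on A B S f"
    and U: "(U, \<phi>) \<in> A" and V: "(V, \<psi>) \<in> B"
    and D: "open D" "D \<subseteq> U" "D \<subseteq> S" "f ` D \<subseteq> V"
  shows "smooth_on (\<phi> ` D) (\<psi> \<circ> f \<circ> inv_into U \<phi>)"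
proof (rule smooth_on_locally)
  fix y assume "y \<in> \<phi> ` D"
  then obtain x where x: "x \<in> D" "y = \<phi> x" by auto
  then have "x \<in> S" using D by blast
  with f obtain U' \<phi>' V' \<psi>' W where *: "(U', \<phi>') \<in> A" "(V', \<psi>') \<in> B" "x \<in> W" "W \<subseteq> U'" "W \<subseteq> S"
    "open (\<phi>' ` W)" "f ` W \<subseteq> V'" "smooth_on (\<phi>' ` W) (\<psi>' \<circ> f \<circ> inv_into U' \<phi>')"
    by (rule smooth_map_onE)
  note [simp] = chart_inv[OF A U] chart_inv[OF A *(1)] chart_inv[OF B V] chart_inv[OF B *(2)]
  have W: "open W" by (rule chart_preimage_open[OF A *(1,6,4)])
  define T where "T = \<phi> ` (D \<inter> W)"
  have T: "open T" unfolding T_def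
    using D W by (intro chart_image_open[OF A U]) auto
  have VV: "open (\<psi>' ` (V' \<inter> V))"
    using chart_open[OF B] *(2) V by (intro chart_image_open[OF B *(2)]) auto
  have 1: "smooth_on T (\<phi>' \<circ> inv_into U \<phi>)"
    using chart_transition[OF A U *(1)] by (rule smooth_on_subset) (use D *(4) in \<open>auto simp: T_def\<close>)
  have 2: "smooth_on T (\<lambda>y. (\<psi>' \<circ> f \<circ> inv_into U' \<phi>') ((\<phi>' \<circ> inv_into U \<phi>) y))"
    by (rule smooth_on_compose[OF smooth_atlas_fin_dim[OF A] T *(6) _ 1 *(8)])
      (use D *(4) in \<open>auto simp: T_def subset_iff\<close>)
  have 3: "smooth_on T (\<lambda>y. (\<psi> \<circ> inv_into V' \<psi>') ((\<psi>' \<circ> f \<circ> inv_into U' \<phi>') ((\<phi>' \<circ> inv_into U \<phi>) y)))"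
    by (rule smooth_on_compose[OF smooth_atlas_fin_dim[OF B] T VV _ 2 chart_transition[OF B *(2) V]])
      (use D *(4,7) in \<open>auto simp: T_def subset_iff image_subset_iff\<close>)
  have "smooth_on T (\<psi> \<circ> f \<circ> inv_into U \<phi>)"
    by (subst smooth_on_cong[OF T, of _ "\<lambda>y. (\<psi> \<circ> inv_into V' \<psi>') ((\<psi>' \<circ> f \<circ> inv_into U' \<phi>') ((\<phi>' \<circ> inv_into U \<phi>) y))"])
      (use D *(4,7) 3 in \<open>auto simp: T_def subset_iff image_subset_iff\<close>)
  then show "\<exists>T. open T \<and> y \<in> T \<and> smooth_on T (\<psi> \<circ> f \<circ> inv_into U \<phi>)"
    using T x *(3) by (auto simp: T_def)
qed

text \<open>Charts are chosen at x, f x and g (f x); \<open>X\<close> and \<open>W\<close> are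
  preimages on which both coordinate expressions are defined, open by continuity.\<close>

lemma smooth_map_on_compose:
  assumes A: "smooth_atlas A" and B: "smooth_atlas B" and C: "smooth_atlas C"
    and f: "smooth_map_on A B S f" and g: "smooth_map_on B C T g" and ST: "f ` S \<subseteq> T"
  shows "smooth_map_on A C S (\<lambda>x. g (f x))"
proof (rule smooth_map_onI)
  fix x assume x: "x \<in> S"
  obtain U \<phi> where U: "(U, \<phi>) \<in> A" "x \<in> U" using A by (rule chart_exists)
  obtain V \<psi> where V: "(V, \<psi>) \<in> B" "f x \<in> V" using B by (rule chart_exists)
  obtain Z \<zeta> where Z: "(Z, \<zeta>) \<in> C" "g (f x) \<in> Z" using C by (rule chart_exists)
  define X where "X = V \<inter> (T \<inter> g -` Z)"
  have X: "open X" unfolding X_def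
    by (intro open_Int chart_open[OF B V(1)] smooth_map_on_preimage_open[OF B C g] chart_open[OF C Z(1)])
  define W where "W = U \<inter> (S \<inter> f -` X)"
  have W: "open W" unfolding W_def
    by (intro open_Int chart_open[OF A U(1)] smooth_map_on_preimage_open[OF A B f] X)
  have 1: "smooth_on (\<phi> ` W) (\<psi> \<circ> f \<circ> inv_into U \<phi>)"
    by (rule smooth_map_on_charts[OF A B f U(1) V(1) W]) (auto simp: W_def X_def)
  have 2: "smooth_on (\<psi> ` X) (\<zeta> \<circ> g \<circ> inv_into V \<psi>)"
    by (rule smooth_map_on_charts[OF B C g V(1) Z(1) X]) (auto simp: X_def)
  have oW: "open (\<phi> ` W)" by (rule chart_image_open[OF A U(1) W]) (auto simp: W_def)
  have oX: "open (\<psi> ` X)" by (rule chart_image_open[OF B V(1) X]) (auto simp: X_def)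
  note [simp] = chart_inv[OF A U(1)] chart_inv[OF B V(1)]
  have 3: "smooth_on (\<phi> ` W) (\<lambda>y. (\<zeta> \<circ> g \<circ> inv_into V \<psi>) ((\<psi> \<circ> f \<circ> inv_into U \<phi>) y))"
    by (rule smooth_on_compose[OF smooth_atlas_fin_dim[OF B] oW oX _ 1 2]) (auto simp: W_def)
  have "smooth_on (\<phi> ` W) (\<zeta> \<circ> (\<lambda>x. g (f x)) \<circ> inv_into U \<phi>)"
    by (subst smooth_on_cong[OF oW, of _ "\<lambda>y. (\<zeta> \<circ> g \<circ> inv_into V \<psi>) ((\<psi> \<circ> f \<circ> inv_into U \<phi>) y)"])
      (use 3 in \<open>auto simp: W_def X_def\<close>)
  moreover have "x \<in> W" using x U V Z ST by (auto simp: W_def X_def)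
  ultimately show "\<exists>U \<phi> V \<psi> W. (U, \<phi>) \<in> A \<and> (V, \<psi>) \<in> C \<and> x \<in> W \<and> W \<subseteq> U \<and> W \<subseteq> S \<and>
    open (\<phi> ` W) \<and> (\<lambda>x. g (f x)) ` W \<subseteq> V \<and> smooth_on (\<phi> ` W) (\<psi> \<circ> (\<lambda>x. g (f x)) \<circ> inv_into U \<phi>)"
    by (intro smooth_map_on_witness[OF U(1) Z(1) _ _ _ oW]) (auto simp: W_def X_def)
qed

lemma smooth_map_on_const:
  assumes A: "smooth_atlas A" and B: "smooth_atlas B" and S: "open S"
  shows "smooth_map_on A B S (\<lambda>x. c)"
proof (rule smooth_map_onI)
  fix x assume x: "x \<in> S"
  obtain U \<phi> where U: "(U, \<phi>) \<in> A" "x \<in> U" using A by (rule chart_exists)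
  obtain V \<psi> where V: "(V, \<psi>) \<in> B" "c \<in> V" using B by (rule chart_exists)
  have "open (\<phi> ` (U \<inter> S))"
    using S chart_open[OF A U(1)] by (intro chart_image_open[OF A U(1)]) auto
  then show "\<exists>U \<phi> V \<psi> W. (U, \<phi>) \<in> A \<and> (V, \<psi>) \<in> B \<and> x \<in> W \<and> W \<subseteq> U \<and> W \<subseteq> S \<and>
    open (\<phi> ` W) \<and> (\<lambda>x. c) ` W \<subseteq> V \<and> smooth_on (\<phi> ` W) (\<psi> \<circ> (\<lambda>x. c) \<circ> inv_into U \<phi>)"
    using U(2) V(2) x
    by (intro smooth_map_on_witness[OF U(1) V(1), of _ "U \<inter> S"]) (auto simp: o_def smooth_on_const)
qed

lemma smooth_map_on_ident:
  assumes A: "smooth_atlas A" and S: "open S"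
  shows "smooth_map_on A A S (\<lambda>x. x)"
proof (rule smooth_map_onI)
  fix x assume x: "x \<in> S"
  obtain U \<phi> where U: "(U, \<phi>) \<in> A" "x \<in> U" using A by (rule chart_exists)
  have o: "open (\<phi> ` (U \<inter> S))"
    using S chart_open[OF A U(1)] by (intro chart_image_open[OF A U(1)]) auto
  have "smooth_on (\<phi> ` (U \<inter> S)) (\<phi> \<circ> (\<lambda>x. x) \<circ> inv_into U \<phi>)"
    using chart_transition[OF A U(1) U(1)] unfolding o_def by (rule smooth_on_subset) blast
  with o show "\<exists>U \<phi> V \<psi> W. (U, \<phi>) \<in> A \<and> (V, \<psi>) \<in> A \<and> x \<in> W \<and> W \<subseteq> U \<and> W \<subseteq> S \<and>
    open (\<phi> ` W) \<and> (\<lambda>x. x) ` W \<subseteq> V \<and> smooth_on (\<phi> ` W) (\<psi> \<circ> (\<lambda>x. x) \<circ> inv_into U \<phi>)"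
    using U(2) x by (intro smooth_map_on_witness[OF U(1) U(1), of _ "U \<inter> S"]) auto
qed

lemma smooth_map_on_Pair:
  assumes A: "smooth_atlas A" and B: "smooth_atlas B" and C: "smooth_atlas C"
    and f: "smooth_map_on A B S f" and g: "smooth_map_on A C S g"
  shows "smooth_map_on A (prod_atlas B C) S (\<lambda>x. (f x, g x))"
proof (rule smooth_map_onI)
  fix x assume x: "x \<in> S"
  obtain U \<phi> where U: "(U, \<phi>) \<in> A" "x \<in> U" using A by (rule chart_exists)
  obtain V \<psi> where V: "(V, \<psi>) \<in> B" "f x \<in> V" using B by (rule chart_exists)
  obtain Z \<zeta> where Z: "(Z, \<zeta>) \<in> C" "g x \<in> Z" using C by (rule chart_exists)
  define W where "W = U \<inter> (S \<inter> f -` V) \<inter> (S \<inter> g -` Z)"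
  have W: "open W" unfolding W_def
    by (intro open_Int[OF open_Int] chart_open[OF A U(1)] smooth_map_on_preimage_open[OF A B f] chart_open[OF B V(1)]
       smooth_map_on_preimage_open[OF A C g] chart_open[OF C Z(1)])
  have 1: "smooth_on (\<phi> ` W) (\<psi> \<circ> f \<circ> inv_into U \<phi>)"
    by (rule smooth_map_on_charts[OF A B f U(1) V(1) W]) (auto simp: W_def)
  have 2: "smooth_on (\<phi> ` W) (\<zeta> \<circ> g \<circ> inv_into U \<phi>)"
    by (rule smooth_map_on_charts[OF A C g U(1) Z(1) W]) (auto simp: W_def)
  have oW: "open (\<phi> ` W)" by (rule chart_image_open[OF A U(1) W]) (auto simp: W_def)
  have "smooth_on (\<phi> ` W) (map_prod \<psi> \<zeta> \<circ> (\<lambda>x. (f x, g x)) \<circ> inv_into U \<phi>)"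
    using smooth_on_Pair[OF oW 1 2] by (simp add: o_def)
  moreover have "(V \<times> Z, map_prod \<psi> \<zeta>) \<in> prod_atlas B C"
    using V(1) Z(1) by (auto simp: prod_atlas_def)
  moreover have "x \<in> W" using x U V Z by (auto simp: W_def)
  ultimately show "\<exists>U \<phi> V \<psi> W. (U, \<phi>) \<in> A \<and> (V, \<psi>) \<in> prod_atlas B C \<and> x \<in> W \<and> W \<subseteq> U \<and> W \<subseteq> S \<and>
    open (\<phi> ` W) \<and> (\<lambda>x. (f x, g x)) ` W \<subseteq> V \<and>
    smooth_on (\<phi> ` W) (\<psi> \<circ> (\<lambda>x. (f x, g x)) \<circ> inv_into U \<phi>)"
    by (intro smooth_map_on_witness[OF U(1), of "V \<times> Z" "map_prod \<psi> \<zeta>" _ _ W] oW) (auto simp: W_def)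
qed

section \<open>Products of manifolds and arithmetic of vector-valued maps\<close>

lemma fin_dim_euclidean: "fin_dim TYPE('a::euclidean_space)"
  unfolding fin_dim_def by (metis finite_Basis span_Basis)

lemma fin_dim_prod:
  assumes "fin_dim TYPE('a::real_normed_vector)" "fin_dim TYPE('b::real_normed_vector)"
  shows "fin_dim TYPE('a \<times> 'b)"
proof -
  obtain B :: "'a set" where B: "finite B" "span B = UNIV"
    using assms(1) by (auto simp: fin_dim_def)
  obtain C :: "'b set" where C: "finite C" "span C = UNIV"
    using assms(2) by (auto simp: fin_dim_def)
  define D where "D = (\<lambda>x. (x, 0::'b)) ` B \<union> (\<lambda>y. (0::'a, y)) ` C"
  have l: "linear (\<lambda>x. (x, 0::'b))" "linear (\<lambda>y. (0::'a, y))"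
    by (auto intro!: linearI)
  have "(x, y) \<in> span D" for x y
  proof -
    have "(x, 0) \<in> span ((\<lambda>x. (x, 0::'b)) ` B)" "(0, y) \<in> span ((\<lambda>y. (0::'a, y)) ` C)"
      using B C by (auto simp: linear_span_image[OF l(1)] linear_span_image[OF l(2)])
    then have "(x, 0) \<in> span D" "(0, y) \<in> span D"
      unfolding D_def by (meson span_mono sup_ge1 sup_ge2 subsetD)+
    from span_add[OF this] show ?thesis by simp
  qed
  then show ?thesis
    unfolding fin_dim_def using B C by (intro exI[of _ D]) (auto simp: D_def)
qed

text \<open>Stated on the image only: elsewhere \<open>inv_into\<close> is arbitrary and need not
  split into components.\<close>

lemma inv_into_map_prod:
  assumes "inj_on f U" "inj_on g V" "y \<in> f ` U \<times> g ` V"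
  shows "inv_into (U \<times> V) (map_prod f g) y = (inv_into U f (fst y), inv_into V g (snd y))"
proof (rule inv_into_f_eq)
  show "inj_on (map_prod f g) (U \<times> V)" by (rule map_prod_inj_on) fact+
qed (use assms in \<open>auto simp: inv_into_into f_inv_into_f\<close>)

lemma smooth_on_fst_snd:
  assumes "open S" shows "smooth_on S fst" "smooth_on S snd"
  using smooth_on_linear[OF assms bounded_linear_fst smooth_on_ident]
    smooth_on_linear[OF assms bounded_linear_snd smooth_on_ident] by auto

text \<open>Composition asks every intermediate space to be a smooth atlas; this concerns P \<times>
  G and M \<times> G, through which the action and the local trivialisations pass.\<close>

lemma smooth_atlas_prod:
  fixes A :: "('a::t2_space, 'e::real_normed_vector) atlas"
    and B :: "('b::t2_space, 'f::real_normed_vector) atlas"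
  assumes A: "smooth_atlas A" and B: "smooth_atlas B"
  shows "smooth_atlas (prod_atlas A B)"
  unfolding smooth_atlas_def
proof (intro conjI)
  show "fin_dim TYPE('e \<times> 'f)"
    by (intro fin_dim_prod smooth_atlas_fin_dim[OF A] smooth_atlas_fin_dim[OF B])
  have "open (U \<times> V) \<and> open (map_prod \<phi> \<psi> ` (U \<times> V)) \<and>
      homeomorphism (U \<times> V) (map_prod \<phi> \<psi> ` (U \<times> V)) (map_prod \<phi> \<psi>) (inv_into (U \<times> V) (map_prod \<phi> \<psi>))"
    if U: "(U, \<phi>) \<in> A" and V: "(V, \<psi>) \<in> B" for U \<phi> V \<psi>
  proof (intro conjI homeomorphismI)
    note hA = chart_homeomorphism[OF A U] and hB = chart_homeomorphism[OF B V]
    have cont: "continuous_on U \<phi>" "continuous_on (\<phi> ` U) (inv_into U \<phi>)"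
      "continuous_on V \<psi>" "continuous_on (\<psi> ` V) (inv_into V \<psi>)"
      using hA hB homeomorphism_cont1 homeomorphism_cont2 by blast+
    note inv = inv_into_map_prod[OF chart_inj_on[OF A U] chart_inj_on[OF B V]]
    have im: "map_prod \<phi> \<psi> ` (U \<times> V) = \<phi> ` U \<times> \<psi> ` V" by (rule map_prod_surj_on) auto
    show "open (U \<times> V)" "open (map_prod \<phi> \<psi> ` (U \<times> V))"
      using hA hB im by (auto intro: open_Times)
    have "continuous_on (U \<times> V) (\<lambda>x. (\<phi> (fst x), \<psi> (snd x)))"
      by (intro continuous_on_Pair continuous_on_compose2[OF cont(1)] continuous_on_compose2[OF cont(3)]
          continuous_intros) auto
    then show "continuous_on (U \<times> V) (map_prod \<phi> \<psi>)"
      by (simp add: map_prod_def case_prod_unfold)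
    have "continuous_on (\<phi> ` U \<times> \<psi> ` V) (\<lambda>y. (inv_into U \<phi> (fst y), inv_into V \<psi> (snd y)))"
      by (intro continuous_on_Pair continuous_on_compose2[OF cont(2)] continuous_on_compose2[OF cont(4)]
          continuous_intros) auto
    then show "continuous_on (map_prod \<phi> \<psi> ` (U \<times> V)) (inv_into (U \<times> V) (map_prod \<phi> \<psi>))"
      unfolding im by (simp add: inv cong: continuous_on_cong)
    show "inv_into (U \<times> V) (map_prod \<phi> \<psi>) ` map_prod \<phi> \<psi> ` (U \<times> V) \<subseteq> U \<times> V"
      by (auto simp only: image_subset_iff intro!: inv_into_into)
    show "map_prod \<phi> \<psi> (inv_into (U \<times> V) (map_prod \<phi> \<psi>) y) = y"
      if "y \<in> map_prod \<phi> \<psi> ` (U \<times> V)" for y using that by (rule f_inv_into_f)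
    show "inv_into (U \<times> V) (map_prod \<phi> \<psi>) (map_prod \<phi> \<psi> x) = x" if "x \<in> U \<times> V" for x
      using that chart_inj_on[OF A U] chart_inj_on[OF B V]
      by (intro inv_into_f_f map_prod_inj_on)
  qed auto
  then show "\<forall>(U, \<phi>)\<in>prod_atlas A B. open U \<and> open (\<phi> ` U) \<and> homeomorphism U (\<phi> ` U) \<phi> (inv_into U \<phi>)"
    unfolding prod_atlas_def by blast
  have "\<exists>(W, \<theta>)\<in>prod_atlas A B. x \<in> W" for x
  proof -
    obtain U \<phi> where U: "(U, \<phi>) \<in> A" "fst x \<in> U" using A by (rule chart_exists)
    obtain V \<psi> where V: "(V, \<psi>) \<in> B" "snd x \<in> V" using B by (rule chart_exists)
    have "(U \<times> V, map_prod \<phi> \<psi>) \<in> prod_atlas A B" using U V by (auto simp: prod_atlas_def)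
    then show ?thesis by (rule bexI[rotated]) (use U V in \<open>auto simp: mem_Times_iff\<close>)
  qed
  then show "(\<Union>(U, \<phi>)\<in>prod_atlas A B. U) = UNIV" by blast
  have "smooth_on (map_prod \<phi> \<psi> ` (U \<times> V \<inter> U' \<times> V'))
      (map_prod \<phi>' \<psi>' \<circ> inv_into (U \<times> V) (map_prod \<phi> \<psi>))"
    if U: "(U, \<phi>) \<in> A" and V: "(V, \<psi>) \<in> B" and U': "(U', \<phi>') \<in> A" and V': "(V', \<psi>') \<in> B"
    for U \<phi> V \<psi> U' \<phi>' V' \<psi>'
  proof -
    define X where "X = \<phi> ` (U \<inter> U')"
    define Y where "Y = \<psi> ` (V \<inter> V')"
    have im: "map_prod \<phi> \<psi> ` (U \<times> V \<inter> U' \<times> V') = X \<times> Y"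
      unfolding X_def Y_def Times_Int_Times by (rule map_prod_surj_on) auto
    have X: "open X" and Y: "open Y"
      unfolding X_def Y_def using chart_open[OF A U] chart_open[OF A U'] chart_open[OF B V] chart_open[OF B V']
      by (auto intro!: chart_image_open[OF A U] chart_image_open[OF B V])
    have XY: "open (X \<times> Y)" using X Y by (rule open_Times)
    have 1: "smooth_on (X \<times> Y) (\<lambda>y. (\<phi>' \<circ> inv_into U \<phi>) (fst y))"
      by (rule smooth_on_compose[OF smooth_atlas_fin_dim[OF A] XY X _ smooth_on_fst_snd(1)[OF XY]])
        (use chart_transition[OF A U U'] in \<open>auto simp: X_def o_def\<close>)
    have 2: "smooth_on (X \<times> Y) (\<lambda>y. (\<psi>' \<circ> inv_into V \<psi>) (snd y))"
      by (rule smooth_on_compose[OF smooth_atlas_fin_dim[OF B] XY Y _ smooth_on_fst_snd(2)[OF XY]])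
        (use chart_transition[OF B V V'] in \<open>auto simp: Y_def o_def\<close>)
    have "(map_prod \<phi>' \<psi>' \<circ> inv_into (U \<times> V) (map_prod \<phi> \<psi>)) y =
        ((\<phi>' \<circ> inv_into U \<phi>) (fst y), (\<psi>' \<circ> inv_into V \<psi>) (snd y))" if "y \<in> X \<times> Y" for y
      using inv_into_map_prod[OF chart_inj_on[OF A U] chart_inj_on[OF B V], of y] that
      by (auto simp: X_def Y_def)
    then show ?thesis
      unfolding im by (subst smooth_on_cong[OF XY]) (assumption, rule smooth_on_Pair[OF XY 1 2])
  qed
  then show "\<forall>(U, \<phi>)\<in>prod_atlas A B. \<forall>(V, \<psi>)\<in>prod_atlas A B. smooth_on (\<phi> ` (U \<inter> V)) (\<psi> \<circ> inv_into U \<phi>)"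
    unfolding prod_atlas_def by blast
qed

text \<open>In product charts both projections are again projections, so one choice of charts serves
  both claims.\<close>

lemma smooth_map_on_fst_snd:
  fixes A :: "('a::t2_space, 'e::real_normed_vector) atlas"
    and B :: "('b::t2_space, 'f::real_normed_vector) atlas"
  assumes A: "smooth_atlas A" and B: "smooth_atlas B"
  shows "smooth_map_on (prod_atlas A B) A UNIV fst" "smooth_map_on (prod_atlas A B) B UNIV snd"
proof -
  have AB: "smooth_atlas (prod_atlas A B)" using A B by (rule smooth_atlas_prod)
  {
    fix x :: "'a \<times> 'b"
    obtain U \<phi> where U: "(U, \<phi>) \<in> A" "fst x \<in> U" using A by (rule chart_exists)
    obtain V \<psi> where V: "(V, \<psi>) \<in> B" "snd x \<in> V" using B by (rule chart_exists)
    define W where "W = U \<times> V"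
    define \<theta> where "\<theta> = map_prod \<phi> \<psi>"
    have W: "(W, \<theta>) \<in> prod_atlas A B" using U V by (auto simp: prod_atlas_def W_def \<theta>_def)
    have o: "open (\<theta> ` W)" using chart_homeomorphism[OF AB W] by blast
    have im: "\<theta> ` W = \<phi> ` U \<times> \<psi> ` V" unfolding W_def \<theta>_def by (rule map_prod_surj_on) auto
    note inv = inv_into_map_prod[OF chart_inj_on[OF A U(1)] chart_inj_on[OF B V(1)], folded W_def \<theta>_def]
    have "smooth_on (\<theta> ` W) (\<phi> \<circ> fst \<circ> inv_into W \<theta>)"
      by (subst smooth_on_cong[OF o, of _ fst])
        (use smooth_on_fst_snd[OF o] in \<open>auto simp: im inv f_inv_into_f\<close>)
    moreover have "smooth_on (\<theta> ` W) (\<psi> \<circ> snd \<circ> inv_into W \<theta>)"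
      by (subst smooth_on_cong[OF o, of _ snd])
        (use smooth_on_fst_snd[OF o] in \<open>auto simp: im inv f_inv_into_f\<close>)
    moreover have "x \<in> W" "fst ` W \<subseteq> U" "snd ` W \<subseteq> V" using U V by (auto simp: W_def mem_Times_iff)
    ultimately have "\<exists>U \<phi>. (U, \<phi>) \<in> A \<and> (\<exists>V \<psi>. (V, \<psi>) \<in> B \<and> (\<exists>W \<theta>. (W, \<theta>) \<in> prod_atlas A B \<and>
        x \<in> W \<and> open (\<theta> ` W) \<and> fst ` W \<subseteq> U \<and> snd ` W \<subseteq> V \<and>
        smooth_on (\<theta> ` W) (\<phi> \<circ> fst \<circ> inv_into W \<theta>) \<and> smooth_on (\<theta> ` W) (\<psi> \<circ> snd \<circ> inv_into W \<theta>)))"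
      using U(1) V(1) W o by blast
  }
  note * = this
  show "smooth_map_on (prod_atlas A B) A UNIV fst"
    by (rule smooth_map_onI) (use * in \<open>meson subset_UNIV order_refl\<close>)
  show "smooth_map_on (prod_atlas A B) B UNIV snd"
    by (rule smooth_map_onI) (use * in \<open>meson subset_UNIV order_refl\<close>)
qed

lemma smooth_atlas_vector:
  "fin_dim TYPE('e::real_normed_vector) \<Longrightarrow> smooth_atlas (vector_atlas :: ('e, 'e) atlas)"
proof -
  have "inv_into UNIV (\<lambda>x. x) = (\<lambda>x::'e. x)" by (auto simp: inv_into_f_f)
  then show "fin_dim TYPE('e) \<Longrightarrow> smooth_atlas (vector_atlas :: ('e, 'e) atlas)"
    by (simp add: smooth_atlas_def vector_atlas_def homeomorphism_ident o_def smooth_on_ident)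
qed

text \<open>A pair of vector-valued maps is thereby one map into a product vector space, and sums
  and multiples become compositions with smooth maps on that space.\<close>

lemma prod_vector_atlas:
  "prod_atlas (vector_atlas :: ('a::real_normed_vector, 'a) atlas) (vector_atlas :: ('b::real_normed_vector, 'b) atlas)
    = vector_atlas"
  by (auto simp: prod_atlas_def vector_atlas_def map_prod_def)

lemma smooth_map_on_vector:
  assumes "open S" "smooth_on S f"
  shows "smooth_map_on vector_atlas vector_atlas S f"
proof -
  have "inv_into UNIV (\<lambda>x. x) = (\<lambda>x::'a. x)" by (auto simp: inv_into_f_f)
  then show ?thesis using assms by (auto simp: smooth_map_on_def vector_atlas_def o_def)
qed

lemma smooth_map_on_linear:
  fixes L :: "'v::real_normed_vector \<Rightarrow> 'w::real_normed_vector"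
  assumes A: "smooth_atlas A" and v: "fin_dim TYPE('v)" and w: "fin_dim TYPE('w)"
    and L: "linear L" and f: "smooth_map_on A vector_atlas S f"
  shows "smooth_map_on A vector_atlas S (\<lambda>x. L (f x))"
  by (rule smooth_map_on_compose[OF A smooth_atlas_vector[OF v] smooth_atlas_vector[OF w] f
        smooth_map_on_vector[OF open_UNIV smooth_on_linear[OF open_UNIV
            fin_dim_bounded_linear[OF v L] smooth_on_ident]]]) simp

lemma smooth_map_on_add:
  fixes f :: "'a::t2_space \<Rightarrow> 'v::real_normed_vector"
  assumes A: "smooth_atlas A" and v: "fin_dim TYPE('v)"
    and f: "smooth_map_on A vector_atlas S f" and g: "smooth_map_on A vector_atlas S g"
  shows "smooth_map_on A vector_atlas S (\<lambda>x. f x + g x)"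
proof -
  have "linear (\<lambda>p::'v \<times> 'v. fst p + snd p)"
    by (auto intro!: linearI simp: algebra_simps)
  from smooth_map_on_linear[OF A fin_dim_prod[OF v v] v this
      smooth_map_on_Pair[OF A smooth_atlas_vector[OF v] smooth_atlas_vector[OF v] f g, unfolded prod_vector_atlas]]
  show ?thesis by simp
qed

lemma smooth_map_on_sum:
  fixes f :: "'i \<Rightarrow> 'a::t2_space \<Rightarrow> 'v::real_normed_vector"
  assumes A: "smooth_atlas A" and v: "fin_dim TYPE('v)" and S: "open S"
    and f: "\<And>i. i \<in> I \<Longrightarrow> smooth_map_on A vector_atlas S (f i)"
  shows "smooth_map_on A vector_atlas S (\<lambda>x. \<Sum>i\<in>I. f i x)"
  using f
  by (induction I rule: infinite_finite_induct)
    (auto intro!: smooth_map_on_add[OF A v] smooth_map_on_const[OF A smooth_atlas_vector[OF v] S])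

lemma smooth_map_on_scaleR:
  fixes g :: "'a::t2_space \<Rightarrow> 'v::real_normed_vector"
  assumes A: "smooth_atlas A" and v: "fin_dim TYPE('v)"
    and f: "smooth_map_on A vector_atlas S f" and g: "smooth_map_on A vector_atlas S g"
  shows "smooth_map_on A vector_atlas S (\<lambda>x. f x *\<^sub>R g x)"
proof -
  note r = fin_dim_euclidean[where 'a = real]
  have "smooth_on UNIV (\<lambda>p::real \<times> 'v. fst p *\<^sub>R snd p)"
    by (rule smooth_on_bilinear[OF open_UNIV bounded_bilinear_scaleR
          smooth_on_fst_snd[OF open_UNIV]])
  from smooth_map_on_compose[OF A smooth_atlas_vector[OF fin_dim_prod[OF r v]] smooth_atlas_vector[OF v]
      smooth_map_on_Pair[OF A smooth_atlas_vector[OF r] smooth_atlas_vector[OF v] f g, unfolded prod_vector_atlas]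
      smooth_map_on_vector[OF open_UNIV this]]
  show ?thesis by simp
qed


section \<open>Sections of the associated bundle\<close>

text \<open>Smoothness on V refers to its real structure. Splitting coefficients into real and
  imaginary parts shows that a complex spanning set together with its multiples by the imaginary
  unit spans over the reals.\<close>

lemma fin_dim_complex_imp_fin_dim:
  fixes sc :: "complex \<Rightarrow> 'v \<Rightarrow> 'v::real_normed_vector"
  assumes "fin_dim_complex sc"
  shows "fin_dim TYPE('v)"
proof -
  interpret V: vector_space sc using assms by (simp add: fin_dim_complex_def)
  have re: "sc (of_real r) v = r *\<^sub>R v" for r v using assms by (simp add: fin_dim_complex_def)
  obtain B where B: "finite B" "V.span B = UNIV" using assms by (auto simp: fin_dim_complex_def)
  define D where "D = B \<union> sc \<i> ` B"
  have "v \<in> span D" for v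
  proof -
    have "v \<in> V.span B" using B by simp
    then obtain c where v: "v = (\<Sum>b\<in>B. sc (c b) b)" unfolding V.span_finite[OF B(1)] by auto
    have "sc (c b) b = Re (c b) *\<^sub>R b + Im (c b) *\<^sub>R sc \<i> b" for b
    proof -
      have "c b = of_real (Re (c b)) + of_real (Im (c b)) * \<i>"
        by (simp add: complex_eq_iff)
      then have "sc (c b) b = sc (of_real (Re (c b)) + of_real (Im (c b)) * \<i>) b" by simp
      also have "\<dots> = Re (c b) *\<^sub>R b + Im (c b) *\<^sub>R sc \<i> b"
        by (simp add: V.scale_left_distrib re flip: V.scale_scale)
      finally show ?thesis .
    qed
    then show ?thesis unfolding v
      by (auto intro!: span_sum span_add span_scale intro: span_base simp: D_def)
  qed
  then show ?thesis unfolding fin_dim_def using B by (intro exI[of _ D]) (auto simp: D_def)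
qed

text \<open>The point \<open>fun_to_section P F x\<close> of the associated bundle is the class \<open>[u, F u]\<close> for any
  \<open>u\<close> over \<open>x\<close>: for equivariant \<open>F\<close> that class is the graph of \<open>F\<close> over the fibre of \<open>x\<close>.\<close>

definition fun_to_section :: "('p, 'ep, 'm, 'em, 'g, 'eg) pfb \<Rightarrow> ('p \<Rightarrow> 'v) \<Rightarrow> 'm \<Rightarrow> ('p \<times> 'v) set"
  where "fun_to_section P F x = {(u, F u) |u. prj P u = x}"

text \<open>The invariance condition separated from smoothness, since it is applied to functions
  whose smoothness is still to be shown. For a representation it amounts to F (u g) = \<pi> (g^-1)
  (F u).\<close>

definition equivariant :: "('p, 'ep, 'm, 'em, 'g, 'eg) pfb \<Rightarrow> ('g \<Rightarrow> 'v \<Rightarrow> 'v) \<Rightarrow> ('p \<Rightarrow> 'v) \<Rightarrow> bool"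
  where "equivariant P \<pi> F \<longleftrightarrow> (\<forall>g u. \<pi> g (F (act P u g)) = F u)"

lemma carr_invariants:
  "carr (invariants P sc \<pi>) = {F. smooth_map_on (tot_atlas P) vector_atlas UNIV F \<and> equivariant P \<pi> F}"
  by (auto simp: invariants_def vec_functions_def equivariant_def fun_eq_iff)

locale associated_bundle =
  fixes P :: "('p::{t2_space,second_countable_topology}, 'ep::real_normed_vector,
               'm::{t2_space,second_countable_topology}, 'em::real_normed_vector,
               'g::{t2_space,second_countable_topology}, 'eg::real_normed_vector) pfb"
    and sc :: "complex \<Rightarrow> 'v \<Rightarrow> 'v::real_normed_vector"
    and \<pi> :: "'g \<Rightarrow> 'v \<Rightarrow> 'v"
  assumes pfb: "principal_fibre_bundle P"
    and fdc: "fin_dim_complex sc"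
    and rep: "lie_representation P sc \<pi>"
begin

sublocale V: vector_space sc
  using fdc by (simp add: fin_dim_complex_def)

sublocale G: Groups.group "gmul P" "gone P" "ginv P"
  using pfb by (simp add: principal_fibre_bundle_def lie_group_def)

lemma fin_dim_V: "fin_dim TYPE('v)"
  using fdc by (rule fin_dim_complex_imp_fin_dim)

lemma vector_atlas_V: "smooth_atlas (vector_atlas :: ('v, 'v) atlas)"
  using fin_dim_V by (rule smooth_atlas_vector)

lemma atlases: "smooth_atlas (tot_atlas P)" "smooth_atlas (base_atlas P)" "smooth_atlas (grp_atlas P)"
  using pfb by (auto simp: principal_fibre_bundle_def lie_group_def intro: smooth_manifold_imp_smooth_atlas)

lemma prj_smooth: "smooth_map_on (tot_atlas P) (base_atlas P) UNIV (prj P)"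
  and act_smooth: "smooth_map_on (prod_atlas (tot_atlas P) (grp_atlas P)) (tot_atlas P) UNIV (\<lambda>(u, g). act P u g)"
  and ginv_smooth: "smooth_map_on (grp_atlas P) (grp_atlas P) UNIV (ginv P)"
  using pfb by (auto simp: principal_fibre_bundle_def lie_group_def)

lemma act_act: "act P (act P u g) h = act P u (gmul P g h)"
  and act_one [simp]: "act P u (gone P) = u"
  and prj_act [simp]: "prj P (act P u g) = prj P u"
  using pfb by (auto simp: principal_fibre_bundle_def)

lemma linear_pi: "Vector_Spaces.linear sc sc (\<pi> g)"
  and pi_mul: "\<pi> (gmul P g h) v = \<pi> g (\<pi> h v)"
  and pi_one [simp]: "\<pi> (gone P) v = v"
  and pi_smooth: "smooth_map_on (grp_atlas P) vector_atlas UNIV (\<lambda>g. \<pi> g v)"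
  using rep by (auto simp: lie_representation_def)

lemma pi_inv [simp]: "\<pi> (ginv P g) (\<pi> g v) = v" "\<pi> g (\<pi> (ginv P g) v) = v"
  by (simp_all flip: pi_mul)

lemma scale_of_real: "sc (of_real r) v = r *\<^sub>R v"
  using fdc by (simp add: fin_dim_complex_def)

lemma linear_imp_real_linear:
  assumes "Vector_Spaces.linear sc sc T" shows "linear T"
proof -
  interpret T: Vector_Spaces.linear sc sc T by fact
  show ?thesis
    by (rule linearI) (simp_all add: T.add T.scale flip: scale_of_real)
qed

section \<open>Fibres as orbits of the structure group\<close>

lemma local_triv_exists:
  obtains U \<gamma> where "x \<in> U" "local_triv P U \<gamma>"
proof -
  have "\<exists>U \<gamma>. x \<in> U \<and> local_triv P U \<gamma>"
    using pfb by (simp add: principal_fibre_bundle_def)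
  then show ?thesis using that by blast
qed

lemma local_triv_bij:
  "local_triv P U \<gamma> \<Longrightarrow> bij_betw (\<lambda>u. (prj P u, \<gamma> u)) (prj P -` U) (U \<times> UNIV)"
  by (simp add: local_triv_def)

lemma local_triv_act: "local_triv P U \<gamma> \<Longrightarrow> prj P u \<in> U \<Longrightarrow> \<gamma> (act P u g) = gmul P (\<gamma> u) g"
  by (simp add: local_triv_def)

lemma fibre_nonempty: "\<exists>u. prj P u = x"
proof -
  obtain U \<gamma> where U: "x \<in> U" "local_triv P U \<gamma>" by (rule local_triv_exists)
  have "(x, gone P) \<in> (\<lambda>u. (prj P u, \<gamma> u)) ` (prj P -` U)"
    using local_triv_bij[OF U(2)] U(1) by (simp add: bij_betw_def)
  then show ?thesis by auto
qed

text \<open>A trivialisation around the fibre turns the action into right translation of G, where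
  the quotient of the two group coordinates solves the equation; injectivity brings the solution
  back to P.\<close>

lemma act_transitive:
  assumes "prj P u = prj P u'"
  obtains g where "u' = act P u g"
proof -
  obtain U \<gamma> where U: "prj P u \<in> U" "local_triv P U \<gamma>" by (rule local_triv_exists)
  define g where "g = gmul P (ginv P (\<gamma> u)) (\<gamma> u')"
  have "\<gamma> (act P u g) = \<gamma> u'"
    using local_triv_act[OF U(2,1)] by (simp add: g_def flip: G.assoc)
  then have "u' = act P u g"
    using local_triv_bij[OF U(2)] U(1) assms by (auto simp: bij_betw_def inj_on_def)
  then show ?thesis by (rule that)
qed

text \<open>The group coordinate of a trivialisation is equivariant, so freeness is cancellation in
  G.\<close>

lemma act_free:
  assumes "act P u g = act P u h" shows "g = h"
proof -
  obtain U \<gamma> where U: "prj P u \<in> U" "local_triv P U \<gamma>" by (rule local_triv_exists)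
  from assms have "gmul P (\<gamma> u) g = gmul P (\<gamma> u) h"
    using local_triv_act[OF U(2,1)] by metis
  then have "gmul P (ginv P (\<gamma> u)) (gmul P (\<gamma> u) g) = gmul P (ginv P (\<gamma> u)) (gmul P (\<gamma> u) h)" by simp
  then show ?thesis by (simp flip: G.assoc)
qed

section \<open>Points and sections of the associated bundle\<close>

lemma equivariant_act: "equivariant P \<pi> F \<Longrightarrow> F (act P u g) = \<pi> (ginv P g) (F u)"
  by (metis equivariant_def pi_inv(1))

lemma class_eq: "assoc_rel P \<pi> `` {(u, v)} = {(act P u g, \<pi> (ginv P g) v) |g. True}"
  by (auto simp: assoc_rel_def)

text \<open>Equivariance puts the class on the graph; transitivity of G on the fibre makes it the
  whole graph.\<close>

lemma class_equivariant:
  assumes "equivariant P \<pi> F"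
  shows "assoc_rel P \<pi> `` {(u, F u)} = fun_to_section P F (prj P u)"
proof -
  have "(act P u g, \<pi> (ginv P g) (F u)) \<in> fun_to_section P F (prj P u)" for g
    using equivariant_act[OF assms] by (simp add: fun_to_section_def)
  moreover have "\<exists>g. u' = act P u g \<and> F u' = \<pi> (ginv P g) (F u)" if eq: "prj P u' = prj P u" for u'
    using act_transitive[OF eq[symmetric]] equivariant_act[OF assms] by metis
  ultimately show ?thesis by (auto simp: class_eq fun_to_section_def)
qed

lemma assoc_proj_fun_to_section: "assoc_proj P (fun_to_section P F x) = x"
proof -
  have "(\<lambda>(u, v). prj P u) ` fun_to_section P F x = {x}"
    using fibre_nonempty[of x] by (force simp: fun_to_section_def)
  then show ?thesis by (simp add: assoc_proj_def)
qed

lemma fun_to_section_total: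
  assumes "equivariant P \<pi> F"
  shows "fun_to_section P F x \<in> UNIV // assoc_rel P \<pi>"
  using fibre_nonempty[of x] class_equivariant[OF assms] by (metis UNIV_I quotientI)

text \<open>(u, v) belongs to its own class, and a graph has only one value over u; this is the
  uniqueness demanded by \<open>THE\<close>.\<close>

lemma section_to_fun_inverse:
  assumes "equivariant P \<pi> F"
  shows "section_to_fun P \<pi> (fun_to_section P F) = F"
proof
  fix u
  show "section_to_fun P \<pi> (fun_to_section P F) u = F u"
    unfolding section_to_fun_def
  proof (rule the_equality)
    show "fun_to_section P F (prj P u) = assoc_rel P \<pi> `` {(u, F u)}"
      using class_equivariant[OF assms] by simp
    fix v assume "fun_to_section P F (prj P u) = assoc_rel P \<pi> `` {(u, v)}"
    moreover have "(u, v) \<in> assoc_rel P \<pi> `` {(u, v)}"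
    proof -
      have "\<pi> (ginv P (gone P)) v = v" using pi_inv(1)[of "gone P" v] by simp
      then show ?thesis unfolding class_eq by (metis (mono_tags, lifting) CollectI act_one)
    qed
    ultimately show "v = F u" by (auto simp: fun_to_section_def)
  qed
qed

text \<open>A class contains exactly one pair over each point of its fibre, at least one by
  transitivity and at most one by freeness. Reading off the vector of that pair gives F.\<close>

lemma section_is_fun_to_section:
  assumes "\<And>x. s x \<in> UNIV // assoc_rel P \<pi>" "\<And>x. assoc_proj P (s x) = x"
  obtains F where "equivariant P \<pi> F" "s = fun_to_section P F"
proof -
  have s: "\<exists>u v. prj P u = x \<and> s x = {(act P u g, \<pi> (ginv P g) v) |g. True}" for x
  proof -
    obtain u v where uv: "s x = assoc_rel P \<pi> `` {(u, v)}"
      using assms(1)[of x] by (auto elim!: quotientE)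
    then have "(\<lambda>(u, v). prj P u) ` s x = {prj P u}"
      by (force simp: class_eq)
    then have "prj P u = x" using assms(2)[of x] by (simp add: assoc_proj_def)
    with uv show ?thesis by (auto simp: class_eq)
  qed
  define F where "F u = (SOME v. (u, v) \<in> s (prj P u))" for u
  have F: "F (act P u g) = \<pi> (ginv P g) v"
    if "s (prj P u) = {(act P u g, \<pi> (ginv P g) v) |g. True}" for u v g
    unfolding F_def using that by (auto intro!: some_equality dest: act_free)
  show ?thesis
  proof
    show "equivariant P \<pi> F"
      unfolding equivariant_def
    proof (intro allI)
      fix g u
      obtain u' v' where u': "prj P u' = prj P u" and
        eq: "s (prj P u') = {(act P u' g, \<pi> (ginv P g) v') |g. True}"
        using s[of "prj P u"] by auto
      obtain k where k: "u = act P u' k" using u' by (rule act_transitive)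
      \<comment> \<open>Both vectors are compared with v' at the reference point u' where the class
        is written down; the group elements leading from u' to the two points give v' in both
        cases.\<close>
      have "\<pi> (gmul P k g) (F (act P u g)) = v'" "\<pi> k (F u) = v'"
        unfolding k act_act F[OF eq] by simp_all
      then show "\<pi> g (F (act P u g)) = F u" by (metis pi_inv(1) pi_mul)
    qed
    show "s = fun_to_section P F"
    proof
      fix x
      obtain u v where u: "prj P u = x" and eq: "s (prj P u) = {(act P u g, \<pi> (ginv P g) v) |g. True}"
        using s[of x] by auto
      have "s x = {(act P u g, F (act P u g)) |g. True}"
        using F[OF eq] eq u by auto
      also have "\<dots> = fun_to_section P F x"
      proof -
        have "\<exists>g. (u', F u') = (act P u g, F (act P u g))" if "prj P u' = x" for u'
          using act_transitive[of u u'] u that by metis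
        then show ?thesis using u by (auto simp: fun_to_section_def)
      qed
      finally show "s x = fun_to_section P F x" .
    qed
  qed
qed

section \<open>Smoothness in local trivialisations\<close>

text \<open>x goes to (x, e) and then through the smooth inverse of the trivialisation. The group
  coordinate e removes \<pi> from the bundle chart, which thus reads off F (\<sigma> x).\<close>

lemma local_triv_section:
  assumes "local_triv P U \<gamma>"
  defines "\<sigma> \<equiv> \<lambda>x. inv_into (prj P -` U) (\<lambda>u. (prj P u, \<gamma> u)) (x, gone P)"
  shows "\<And>x. x \<in> U \<Longrightarrow> prj P (\<sigma> x) = x" "\<And>x. x \<in> U \<Longrightarrow> \<gamma> (\<sigma> x) = gone P"
    "smooth_map_on (base_atlas P) (tot_atlas P) U \<sigma>"
proof -
  have "(prj P (\<sigma> x), \<gamma> (\<sigma> x)) = (x, gone P)" if "x \<in> U" for x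
    using f_inv_into_f[of "(x, gone P)" "\<lambda>u. (prj P u, \<gamma> u)" "prj P -` U"]
      local_triv_bij[OF assms(1)] that by (simp add: \<sigma>_def bij_betw_def)
  then show "\<And>x. x \<in> U \<Longrightarrow> prj P (\<sigma> x) = x" "\<And>x. x \<in> U \<Longrightarrow> \<gamma> (\<sigma> x) = gone P" by auto
  have U: "open U" and smooth: "smooth_map_on (prod_atlas (base_atlas P) (grp_atlas P)) (tot_atlas P)
         (U \<times> UNIV) (inv_into (prj P -` U) (\<lambda>u. (prj P u, \<gamma> u)))"
    using assms(1) by (auto simp: local_triv_def)
  show "smooth_map_on (base_atlas P) (tot_atlas P) U \<sigma>"
    unfolding \<sigma>_def
    by (rule smooth_map_on_compose[OF atlases(2) smooth_atlas_prod[OF atlases(2,3)] atlases(1)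
          smooth_map_on_Pair[OF atlases(2,2,3) smooth_map_on_ident[OF atlases(2) U]
            smooth_map_on_const[OF atlases(2,3) U]] smooth]) auto
qed

lemma local_triv_smooth:
  assumes "local_triv P U \<gamma>"
  shows "smooth_map_on (tot_atlas P) (grp_atlas P) (prj P -` U) \<gamma>"
proof -
  have "smooth_map_on (tot_atlas P) (prod_atlas (base_atlas P) (grp_atlas P)) (prj P -` U) (\<lambda>u. (prj P u, \<gamma> u))"
    using assms by (simp add: local_triv_def)
  from smooth_map_on_compose[OF atlases(1) smooth_atlas_prod[OF atlases(2,3)] atlases(3) this
      smooth_map_on_fst_snd(2)[OF atlases(2,3)]]
  show ?thesis by simp
qed

text \<open>Along the fibre \<gamma> picks up g on the right, and \<pi> g undoes the change of F, so
  the vector is constant and \<open>the_elem\<close> has a singleton to read.\<close>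

lemma chart_value:
  assumes "local_triv P U \<gamma>" "prj P u \<in> U" "equivariant P \<pi> F"
  shows "the_elem ((\<lambda>(u, v). \<pi> (\<gamma> u) v) ` fun_to_section P F (prj P u)) = \<pi> (\<gamma> u) (F u)"
proof -
  have *: "\<pi> (\<gamma> u') (F u') = \<pi> (\<gamma> u) (F u)" if eq: "prj P u' = prj P u" for u'
  proof -
    obtain g where "u' = act P u g" using eq[symmetric] by (rule act_transitive)
    then show ?thesis
      using local_triv_act[OF assms(1,2)] assms(3) by (simp add: pi_mul equivariant_def)
  qed
  have "(\<lambda>(u, v). \<pi> (\<gamma> u) v) ` fun_to_section P F (prj P u) = {\<pi> (\<gamma> u) (F u)}"
  proof (intro equalityI subsetI)
    fix y assume "y \<in> (\<lambda>(u, v). \<pi> (\<gamma> u) v) ` fun_to_section P F (prj P u)"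
    then obtain u' where "prj P u' = prj P u" "y = \<pi> (\<gamma> u') (F u')"
      by (auto simp only: fun_to_section_def image_iff mem_Collect_eq prod.case bex_simps)
    then show "y \<in> {\<pi> (\<gamma> u) (F u)}" using *[of u'] by simp
  next
    fix y assume "y \<in> {\<pi> (\<gamma> u) (F u)}"
    then show "y \<in> (\<lambda>(u, v). \<pi> (\<gamma> u) v) ` fun_to_section P F (prj P u)"
      by (auto simp: fun_to_section_def)
  qed
  then show ?thesis by simp
qed

text \<open>In a real basis of V the moving vector contributes smooth coefficients, while \<pi> acts
  on finitely many fixed vectors, where it is smooth by assumption.\<close>

lemma pi_apply_smooth:
  assumes A: "smooth_atlas A" and g: "smooth_map_on A (grp_atlas P) S g"
    and w: "smooth_map_on A vector_atlas S w"
  shows "smooth_map_on A vector_atlas S (\<lambda>x. \<pi> (g x) (w x))"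
proof -
  obtain B :: "'v set" where B: "finite B" "independent B" "span B = UNIV"
    using fin_dim_V by (rule fin_dim_basis)
  have lin: "linear (\<lambda>v. representation B v b)" for b
    using B by (intro linearI) (auto simp: representation_add representation_scale)
  have "\<pi> (g x) (w x) = (\<Sum>b\<in>B. representation B (w x) b *\<^sub>R \<pi> (g x) b)" for x
  proof -
    have l: "linear (\<pi> (g x))" by (rule linear_imp_real_linear[OF linear_pi])
    have "w x = (\<Sum>b\<in>B. representation B (w x) b *\<^sub>R b)"
      using B by (simp add: real_vector.sum_representation_eq)
    then have "\<pi> (g x) (w x) = \<pi> (g x) \<dots>" by simp
    also have "\<dots> = (\<Sum>b\<in>B. representation B (w x) b *\<^sub>R \<pi> (g x) b)"
      using l by (simp add: linear_sum linear_scale)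
    finally show ?thesis .
  qed
  moreover have "smooth_map_on A vector_atlas S (\<lambda>x. \<Sum>b\<in>B. representation B (w x) b *\<^sub>R \<pi> (g x) b)"
    by (rule smooth_map_on_sum[OF A fin_dim_V smooth_map_on_open[OF A g]],
        rule smooth_map_on_scaleR[OF A fin_dim_V],
        rule smooth_map_on_linear[OF A fin_dim_V fin_dim_euclidean lin w],
        rule smooth_map_on_compose[OF A atlases(3) vector_atlas_V g pi_smooth]) simp
  ultimately show ?thesis by simp
qed

abbreviation "bundle \<equiv> assoc_bundle P sc \<pi>"

text \<open>The chart of E is built from the base chart and the trivialisation chosen around x; in
  it the section reads (\<phi> z, F (\<sigma> z)).\<close>

lemma fun_to_section_smooth:
  assumes F: "equivariant P \<pi> F" and smooth: "smooth_map_on (tot_atlas P) vector_atlas UNIV F"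
  shows "smooth_map_on (base_atlas P) (vb_atlas bundle) UNIV (fun_to_section P F)"
proof (rule smooth_map_onI)
  fix x
  obtain U \<gamma> where U: "x \<in> U" "local_triv P U \<gamma>" by (rule local_triv_exists)
  obtain W \<phi> where W: "(W, \<phi>) \<in> base_atlas P" "x \<in> W" using atlases(2) by (rule chart_exists)
  define \<sigma> where "\<sigma> x = inv_into (prj P -` U) (\<lambda>u. (prj P u, \<gamma> u)) (x, gone P)" for x
  note sec = local_triv_section[OF U(2), folded \<sigma>_def]
  define D where "D = {c \<in> UNIV // assoc_rel P \<pi>. assoc_proj P c \<in> U \<inter> W}"
  define \<Psi> where "\<Psi> c = (\<phi> (assoc_proj P c), the_elem ((\<lambda>(u, v). \<pi> (\<gamma> u) v) ` c))" for c
  have chart: "(D, \<Psi>) \<in> vb_atlas bundle"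
    using U(2) W(1) unfolding assoc_bundle_def D_def \<Psi>_def by auto
  define X where "X = U \<inter> W"
  have "open U" using U(2) by (simp add: local_triv_def)
  then have X: "open X" unfolding X_def by (rule open_Int) (rule chart_open[OF atlases(2) W(1)])
  have oX: "open (\<phi> ` X)" by (rule chart_image_open[OF atlases(2) W(1) X]) (simp add: X_def)
  have 1: "smooth_on (\<phi> ` X) (\<phi> \<circ> inv_into W \<phi>)"
    by (rule smooth_on_subset[OF chart_transition[OF atlases(2) W(1) W(1)]]) (auto simp: X_def)
  have "smooth_map_on (base_atlas P) vector_atlas U (\<lambda>x. F (\<sigma> x))"
    by (rule smooth_map_on_compose[OF atlases(2,1) vector_atlas_V sec(3) smooth]) simp
  then have 2: "smooth_on (\<phi> ` X) ((\<lambda>y. y) \<circ> (\<lambda>x. F (\<sigma> x)) \<circ> inv_into W \<phi>)"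
    by (rule smooth_map_on_charts[OF atlases(2) vector_atlas_V _ W(1), where V = UNIV])
      (use X in \<open>auto simp: X_def vector_atlas_def\<close>)
  have val: "\<Psi> (fun_to_section P F z) = (\<phi> z, F (\<sigma> z))" if "z \<in> U" for z
    using chart_value[OF U(2) _ F, of "\<sigma> z"] sec(1,2)[OF that] that
    by (simp add: \<Psi>_def assoc_proj_fun_to_section)
  have "smooth_on (\<phi> ` X) (\<Psi> \<circ> fun_to_section P F \<circ> inv_into W \<phi>)"
  proof (subst smooth_on_cong[OF oX])
    show "(\<Psi> \<circ> fun_to_section P F \<circ> inv_into W \<phi>) y =
        ((\<phi> \<circ> inv_into W \<phi>) y, ((\<lambda>y. y) \<circ> (\<lambda>x. F (\<sigma> x)) \<circ> inv_into W \<phi>) y)" if "y \<in> \<phi> ` X" for y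
      using that by (auto simp: X_def val chart_inv[OF atlases(2) W(1)])
  qed (rule smooth_on_Pair[OF oX 1 2])
  moreover have "fun_to_section P F ` X \<subseteq> D"
    by (auto simp: D_def X_def assoc_proj_fun_to_section fun_to_section_total[OF F])
  ultimately show "\<exists>U \<phi> V \<psi> W. (U, \<phi>) \<in> base_atlas P \<and> (V, \<psi>) \<in> vb_atlas bundle \<and> x \<in> W \<and> W \<subseteq> U \<and>
      W \<subseteq> UNIV \<and> open (\<phi> ` W) \<and> fun_to_section P F ` W \<subseteq> V \<and>
      smooth_on (\<phi> ` W) (\<psi> \<circ> fun_to_section P F \<circ> inv_into U \<phi>)"
    using U(1) W(2) by (intro smooth_map_on_witness[OF W(1) chart _ _ _ oX]) (auto simp: X_def)
qed

text \<open>The chart of E comes from some trivialisation and a base chart unrelated to the one on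
  the source side. Only its fibre component \<open>w\<close> is used; undoing \<pi> (\<gamma> u) in
  it recovers F over \<open>X\<close>.\<close>

lemma fun_to_section_smooth_imp:
  assumes F: "equivariant P \<pi> F"
    and smooth: "smooth_map_on (base_atlas P) (vb_atlas bundle) UNIV (fun_to_section P F)"
  shows "smooth_map_on (tot_atlas P) vector_atlas UNIV F"
proof (rule smooth_map_on_locally)
  fix u
  obtain Y \<theta> D \<Psi> X where Y: "(Y, \<theta>) \<in> base_atlas P" "X \<subseteq> Y"
    and chart: "(D, \<Psi>) \<in> vb_atlas bundle" and X: "prj P u \<in> X" "open (\<theta> ` X)" "fun_to_section P F ` X \<subseteq> D"
    and sm: "smooth_on (\<theta> ` X) (\<Psi> \<circ> fun_to_section P F \<circ> inv_into Y \<theta>)"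
    by (rule smooth_map_onE[OF smooth UNIV_I[of "prj P u"]])
  obtain U \<gamma> W \<phi> where U: "local_triv P U \<gamma>"
    and D: "D = {c \<in> UNIV // assoc_rel P \<pi>. assoc_proj P c \<in> U \<inter> W}"
    and \<Psi>: "\<Psi> = (\<lambda>c. (\<phi> (assoc_proj P c), the_elem ((\<lambda>(u, v). \<pi> (\<gamma> u) v) ` c)))"
    using chart by (auto simp: assoc_bundle_def)
  \<comment> \<open>The witness is mapped into the chart domain \<open>D\<close>, so the
    trivialisation covers all of \<open>X\<close>.\<close>
  have XU: "x \<in> U" if "x \<in> X" for x
    using X(3) that by (auto simp: D assoc_proj_fun_to_section)
  define w where "w x = snd (\<Psi> (fun_to_section P F x))" for x
  have "smooth_on (\<theta> ` X) ((\<lambda>y. y) \<circ> w \<circ> inv_into Y \<theta>)"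
    using smooth_on_linear[OF X(2) bounded_linear_snd sm] by (simp add: o_def w_def)
  then have w: "smooth_map_on (base_atlas P) vector_atlas X w"
    using Y X by (intro smooth_map_onI smooth_map_on_witness[OF Y(1), of UNIV "\<lambda>y. y"])
      (auto simp: vector_atlas_def)
  define S where "S = prj P -` X"
  have oS: "open S"
    using smooth_map_on_preimage_open[OF atlases(1,2) prj_smooth chart_preimage_open[OF atlases(2) Y(1) X(2) Y(2)]]
    by (simp add: S_def)
  have prjS: "smooth_map_on (tot_atlas P) (base_atlas P) S (prj P)"
    by (rule smooth_map_on_subset[OF atlases(1) prj_smooth oS]) simp
  have \<gamma>S: "smooth_map_on (tot_atlas P) (grp_atlas P) S \<gamma>"
    by (rule smooth_map_on_subset[OF atlases(1) local_triv_smooth[OF U] oS]) (use XU in \<open>auto simp: S_def\<close>)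
  have "smooth_map_on (tot_atlas P) vector_atlas S (\<lambda>u. \<pi> (ginv P (\<gamma> u)) (w (prj P u)))"
    by (rule pi_apply_smooth[OF atlases(1) smooth_map_on_compose[OF atlases(1,3,3) \<gamma>S ginv_smooth]
          smooth_map_on_compose[OF atlases(1,2) vector_atlas_V prjS w]])
      (auto simp: S_def)
  moreover have "\<pi> (ginv P (\<gamma> u)) (w (prj P u)) = F u" if "u \<in> S" for u
    using that chart_value[OF U _ F] XU by (simp add: S_def w_def \<Psi>)
  ultimately have "smooth_map_on (tot_atlas P) vector_atlas S F"
    by (rule smooth_map_on_cong[OF atlases(1)])
  then show "\<exists>T. u \<in> T \<and> T \<subseteq> UNIV \<and> smooth_map_on (tot_atlas P) vector_atlas T F"
    using X(1) by (auto simp: S_def)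
qed

section \<open>Sections identified with invariant functions\<close>

abbreviation "\<Gamma> \<equiv> smooth_sections (base_atlas P) bundle"
abbreviation "I \<equiv> invariants P sc \<pi>"

text \<open>From here on a section is handled as the image of an invariant function, which reduces
  statements about \<Gamma> to statements about V-valued functions.\<close>

lemma carr_sections: "carr \<Gamma> = fun_to_section P ` carr I"
proof (rule set_eqI, rule iffI)
  fix s assume "s \<in> carr \<Gamma>"
  then have s: "\<And>x. s x \<in> UNIV // assoc_rel P \<pi>" "\<And>x. assoc_proj P (s x) = x"
    "smooth_map_on (base_atlas P) (vb_atlas bundle) UNIV s"
    by (simp_all add: smooth_sections_def assoc_bundle_def)
  obtain F where F: "equivariant P \<pi> F" "s = fun_to_section P F"
    using s(1,2) by (rule section_is_fun_to_section)
  then show "s \<in> fun_to_section P ` carr I"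
    using fun_to_section_smooth_imp[OF F(1)] s(3) by (auto simp: carr_invariants)
next
  fix s assume "s \<in> fun_to_section P ` carr I"
  then obtain F where F: "equivariant P \<pi> F" "smooth_map_on (tot_atlas P) vector_atlas UNIV F"
    "s = fun_to_section P F" by (auto simp: carr_invariants)
  then have "smooth_map_on (base_atlas P) (vb_atlas bundle) UNIV s"
    using fun_to_section_smooth by simp
  then show "s \<in> carr \<Gamma>"
    by (simp add: F(3) fun_to_section_total[OF F(1)] assoc_proj_fun_to_section
        smooth_sections_def assoc_bundle_def)
qed

lemma section_to_fun_fun_to_section: "F \<in> carr I \<Longrightarrow> section_to_fun P \<pi> (fun_to_section P F) = F"
  by (rule section_to_fun_inverse) (simp add: carr_invariants)

lemma bij_section_to_fun: "bij_betw (section_to_fun P \<pi>) (carr \<Gamma>) (carr I)"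
  by (rule bij_betw_byWitness[where f' = "fun_to_section P"])
    (auto simp: carr_sections section_to_fun_fun_to_section)

lemma inv_section_to_fun:
  "F \<in> carr I \<Longrightarrow> inv_into (carr \<Gamma>) (section_to_fun P \<pi>) F = fun_to_section P F"
  by (rule inv_into_f_eq[OF bij_betw_imp_inj_on[OF bij_section_to_fun]])
    (auto simp: carr_sections section_to_fun_fun_to_section)

text \<open>The set expression for the sum in the bundle pairs up vectors over the same point of P,
  so on graphs it is pointwise addition; scaling and zero behave likewise.\<close>

lemma vadd_fun_to_section:
  "vadd \<Gamma> (fun_to_section P F) (fun_to_section P H) = fun_to_section P (vadd I F H)"
  by (auto simp: smooth_sections_def assoc_bundle_def invariants_def vec_functions_def fun_to_section_def fun_eq_iff)

lemma vscale_fun_to_section: "vscale \<Gamma> c (fun_to_section P F) = fun_to_section P (vscale I c F)"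
  by (auto simp: smooth_sections_def assoc_bundle_def invariants_def vec_functions_def fun_to_section_def fun_eq_iff)

lemma vzero_sections: "vzero \<Gamma> = fun_to_section P (vzero I)"
  by (auto simp: smooth_sections_def assoc_bundle_def invariants_def vec_functions_def fun_to_section_def fun_eq_iff)

lemma vb_scale_fun_to_section:
  "(\<lambda>x. vb_scale bundle (a x) (fun_to_section P F x)) = fun_to_section P (\<lambda>u. sc (a (prj P u)) (F u))"
  by (auto simp: assoc_bundle_def fun_to_section_def fun_eq_iff)

end


section \<open>Operators on vector-valued functions\<close>

text \<open>Trades the fold over a list for finite sums, which can be split and swapped.\<close>

lemma lambda_ext_pointwise:
  fixes Z :: "('x \<Rightarrow> 'v::comm_monoid_add) cspace"
  assumes "vadd Z = (\<lambda>f g x. f x + g x)" "vzero Z = (\<lambda>x. 0)"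
  shows "lambda_ext Z D F a n x = (\<Sum>r\<le>n. \<Sum>i\<le>n - r. D r (F i) (a (n - r - i)) x)"
proof -
  have fold: "foldr (vadd Z) fs (vzero Z) x = sum_list (map (\<lambda>f. f x) fs)" for fs
    by (induction fs) (simp_all add: assms)
  have conc: "sum_list (concat xss) = sum_list (map sum_list xss)" for xss :: "'v list list"
    by (induction xss) simp_all
  have le: "{0..<Suc k} = {..k}" for k by auto
  show ?thesis
    unfolding lambda_ext_def fold
    by (simp add: map_concat conc o_def interv_sum_list_conv_sum_set_nat le del: upt_Suc)
qed

text \<open>An additive map passes through the fold; this later carries the multiplication on
  functions over to sections.\<close>

lemma lambda_ext_image:
  assumes "\<And>x y. vadd Z (\<Phi> x) (\<Phi> y) = \<Phi> (vadd S x y)" "vzero Z = \<Phi> (vzero S)"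
  shows "lambda_ext Z (\<lambda>r s a. \<Phi> (D r s a)) F a n = \<Phi> (lambda_ext S D F a n)"
proof -
  have "foldr (vadd Z) (map \<Phi> xs) (vzero Z) = \<Phi> (foldr (vadd S) xs (vzero S))" for xs
    by (induction xs) (simp_all add: assms)
  from this[symmetric] show ?thesis
    by (simp add: lambda_ext_def map_concat o_def del: upt_Suc)
qed

lemma lambda_ext_closed:
  assumes "\<And>x y. x \<in> carr Z \<Longrightarrow> y \<in> carr Z \<Longrightarrow> vadd Z x y \<in> carr Z" "vzero Z \<in> carr Z"
    and "\<And>r x y. x \<in> carr X \<Longrightarrow> y \<in> carr Y \<Longrightarrow> D r x y \<in> carr Z"
    and "F \<in> formal X" "a \<in> formal Y"
  shows "lambda_ext Z D F a \<in> formal Z"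
proof -
  have fold: "foldr (vadd Z) xs (vzero Z) \<in> carr Z" if "set xs \<subseteq> carr Z" for xs
    using that by (induction xs) (auto intro: assms(1,2))
  have "F i \<in> carr X" "a i \<in> carr Y" for i
    using assms(4,5) by (simp_all add: formal_def)
  then have "D r (F i) (a j) \<in> carr Z" for r i j by (rule assms(3))
  then show ?thesis
    unfolding formal_def mem_Collect_eq lambda_ext_def by (intro allI fold) auto
qed

lemma smooth_functions_simps [simp]:
  "vadd (smooth_functions A) = (\<lambda>f g x. f x + g x)" "vzero (smooth_functions A) = (\<lambda>x. 0)"
  "vscale (smooth_functions A) = (\<lambda>c f x. c * f x)"
  by (simp_all add: smooth_functions_def)

lemma carr_smooth_functions: "f \<in> carr (smooth_functions A) \<longleftrightarrow> smooth_map_on A vector_atlas UNIV f"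
  by (simp add: smooth_functions_def)

lemma vec_functions_simps [simp]:
  "vadd (vec_functions A sc) = (\<lambda>f g x. f x + g x)" "vzero (vec_functions A sc) = (\<lambda>x. 0)"
  "vscale (vec_functions A sc) = (\<lambda>c f x. sc c (f x))"
  by (simp_all add: vec_functions_def)

lemma carr_vec_functions: "f \<in> carr (vec_functions A sc) \<longleftrightarrow> smooth_map_on A vector_atlas UNIV f"
  by (simp add: vec_functions_def)

lemma invariants_simps [simp]:
  "vadd (invariants P sc \<pi>) = (\<lambda>f g x. f x + g x)" "vzero (invariants P sc \<pi>) = (\<lambda>x. 0)"
  "vscale (invariants P sc \<pi>) = (\<lambda>c f x. sc c (f x))"
  by (simp_all add: invariants_def)

lemma smooth_functions_add:
  assumes "smooth_atlas A" "f \<in> carr (smooth_functions A)" "g \<in> carr (smooth_functions A)"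
  shows "(\<lambda>x. f x + g x) \<in> carr (smooth_functions A)"
  using assms smooth_map_on_add[OF assms(1) fin_dim_euclidean] by (simp add: carr_smooth_functions)

lemma smooth_functions_scale:
  assumes "smooth_atlas A" "f \<in> carr (smooth_functions A)"
  shows "(\<lambda>x. c * f x) \<in> carr (smooth_functions A)"
proof -
  have "linear (\<lambda>z::complex. c * z)" by (rule linearI) (simp_all add: algebra_simps)
  from smooth_map_on_linear[OF assms(1) fin_dim_euclidean fin_dim_euclidean this] assms(2)
  show ?thesis by (simp add: carr_smooth_functions)
qed

lemma smooth_functions_const:
  "smooth_atlas A \<Longrightarrow> (\<lambda>x. c) \<in> carr (smooth_functions A)"
  using smooth_map_on_const[OF _ smooth_atlas_vector[OF fin_dim_euclidean] open_UNIV]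
  by (simp add: carr_smooth_functions)

lemma smooth_functions_sum:
  assumes "smooth_atlas A" "\<And>i. i \<in> S \<Longrightarrow> f i \<in> carr (smooth_functions A)"
  shows "(\<lambda>x. \<Sum>i\<in>S. f i x) \<in> carr (smooth_functions A)"
  using assms(2) unfolding carr_smooth_functions
  by (rule smooth_map_on_sum[OF assms(1) fin_dim_euclidean open_UNIV])

lemma constant_series_formal:
  assumes "smooth_atlas A" "f \<in> carr (smooth_functions A)"
  shows "(\<lambda>n x. if n = 0 then f x else 0) \<in> formal (smooth_functions A)"
proof -
  have "(\<lambda>x. if n = (0::nat) then f x else 0) \<in> carr (smooth_functions A)" for n
    using assms smooth_functions_const[OF assms(1), of 0] by (cases "n = 0") simp_all
  then show ?thesis by (simp add: formal_def)
qed

context associated_bundle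
begin

section \<open>Complex coordinates on V\<close>

definition "basis = (SOME B. finite B \<and> V.independent B \<and> V.span B = UNIV)"

definition "coord b v = V.representation basis v b"

lemma basis: "finite basis" "V.independent basis" "V.span basis = UNIV"
proof -
  obtain C where C: "finite C" "V.span C = UNIV" using fdc by (auto simp: fin_dim_complex_def)
  obtain B where B: "B \<subseteq> C" "V.independent B" "C \<subseteq> V.span B"
    by (rule V.maximal_independent_subset[of C])
  have "V.span C \<subseteq> V.span B" using B(3) by (metis V.span_mono V.span_span)
  with C B have "\<exists>B. finite B \<and> V.independent B \<and> V.span B = UNIV"
    by (intro exI[of _ B]) (auto intro: finite_subset)
  from someI_ex[OF this, folded basis_def]
  show "finite basis" "V.independent basis" "V.span basis = UNIV" by auto
qed

lemma sum_coord: "(\<Sum>b\<in>basis. sc (coord b v) b) = v"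
  unfolding coord_def using basis by (simp add: V.sum_representation_eq)

lemma coord_add: "coord b (v + w) = coord b v + coord b w"
  unfolding coord_def using basis by (simp add: V.representation_add)

lemma coord_scale: "coord b (sc c v) = c * coord b v"
  unfolding coord_def using basis by (simp add: V.representation_scale)

lemma coord_linear: "linear (coord b)"
  by (rule linearI) (simp_all add: coord_add coord_scale scaleR_conv_of_real flip: scale_of_real)

lemma coord_sum: "coord b (\<Sum>i\<in>S. f i) = (\<Sum>i\<in>S. coord b (f i))"
  using linear_sum[OF coord_linear] by blast

lemma coord_basis: "b \<in> basis \<Longrightarrow> coord c b = (if c = b then 1 else 0)"
  unfolding coord_def using basis by (simp add: V.representation_basis)

lemma coord_combination: "b \<in> basis \<Longrightarrow> coord b (\<Sum>c\<in>basis. sc (k c) c) = k b"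
proof -
  assume b: "b \<in> basis"
  have "coord b (\<Sum>c\<in>basis. sc (k c) c) = (\<Sum>c\<in>basis. if b = c then k c else 0)"
    unfolding coord_sum by (intro sum.cong) (auto simp: coord_scale coord_basis)
  then show ?thesis using b basis(1) by simp
qed

abbreviation "CP \<equiv> smooth_functions (tot_atlas P)"
abbreviation "CM \<equiv> smooth_functions (base_atlas P)"
abbreviation "CPV \<equiv> vec_functions (tot_atlas P) sc"

lemma coord_smooth: "F \<in> carr CPV \<Longrightarrow> (\<lambda>u. coord b (F u)) \<in> carr CP"
  using smooth_map_on_linear[OF atlases(1) fin_dim_V fin_dim_euclidean coord_linear]
  by (simp add: carr_smooth_functions carr_vec_functions)

lemma scale_smooth:
  assumes "f \<in> carr CP" shows "(\<lambda>u. sc (f u) w) \<in> carr CPV"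
proof -
  have "linear (\<lambda>z. sc z w)"
    by (rule linearI) (simp_all add: V.scale_left_distrib scaleR_conv_of_real flip: scale_of_real)
  from smooth_map_on_linear[OF atlases(1) fin_dim_euclidean fin_dim_V this] assms
  show ?thesis by (simp add: carr_smooth_functions carr_vec_functions)
qed

lemma vec_add_smooth: "F \<in> carr CPV \<Longrightarrow> H \<in> carr CPV \<Longrightarrow> (\<lambda>u. F u + H u) \<in> carr CPV"
  using smooth_map_on_add[OF atlases(1) fin_dim_V] by (simp add: carr_vec_functions)

lemma vec_sum_smooth:
  "(\<And>i. i \<in> S \<Longrightarrow> F i \<in> carr CPV) \<Longrightarrow> (\<lambda>u. \<Sum>i\<in>S. F i u) \<in> carr CPV"
  unfolding carr_vec_functions by (rule smooth_map_on_sum[OF atlases(1) fin_dim_V open_UNIV])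

lemma vec_zero_smooth: "(\<lambda>u. 0) \<in> carr CPV"
  using smooth_map_on_const[OF atlases(1) vector_atlas_V open_UNIV] by (simp add: carr_vec_functions)

section \<open>Extending linear operators on functions to V-valued functions\<close>

text \<open>The instances are the maps from f to \<rho> r f a with a fixed; linearity over the
  complex numbers lets constant coefficients be pulled through.\<close>

definition linear_operator :: "(('p \<Rightarrow> complex) \<Rightarrow> ('p \<Rightarrow> complex)) \<Rightarrow> bool"
  where
    "linear_operator D \<longleftrightarrow> (\<forall>f\<in>carr CP. D f \<in> carr CP) \<and>
       (\<forall>f\<in>carr CP. \<forall>g\<in>carr CP. D (\<lambda>u. f u + g u) = (\<lambda>u. D f u + D g u)) \<and>
       (\<forall>c. \<forall>f\<in>carr CP. D (\<lambda>u. c * f u) = (\<lambda>u. c * D f u))"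

lemma linear_operatorD:
  assumes "linear_operator D"
  shows "f \<in> carr CP \<Longrightarrow> D f \<in> carr CP"
    "f \<in> carr CP \<Longrightarrow> g \<in> carr CP \<Longrightarrow> D (\<lambda>u. f u + g u) = (\<lambda>u. D f u + D g u)"
    "f \<in> carr CP \<Longrightarrow> D (\<lambda>u. c * f u) = (\<lambda>u. c * D f u)"
  using assms by (auto simp: linear_operator_def)

lemma linear_operator_zero: "linear_operator D \<Longrightarrow> D (\<lambda>u. 0) = (\<lambda>u. 0)"
  using linear_operatorD(3)[OF _ smooth_functions_const[OF atlases(1)], of D 0 0] by simp

lemma linear_operator_sum:
  assumes D: "linear_operator D" and "\<And>i. i \<in> S \<Longrightarrow> f i \<in> carr CP"
  shows "D (\<lambda>u. \<Sum>i\<in>S. c i * f i u) = (\<lambda>u. \<Sum>i\<in>S. c i * D (f i) u)"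
  using assms(2)
proof (induction S rule: infinite_finite_induct)
  case (insert i S)
  have "D (\<lambda>u. c i * f i u + (\<Sum>i\<in>S. c i * f i u)) = (\<lambda>u. c i * D (f i) u + (\<Sum>i\<in>S. c i * D (f i) u))"
    using insert
    by (subst linear_operatorD(2)[OF D])
      (auto simp: linear_operatorD(3)[OF D] intro!: smooth_functions_sum smooth_functions_scale atlases)
  then show ?case using insert(1,2) by simp
qed (simp_all add: linear_operator_zero[OF D])

text \<open>\<open>D \<otimes> id\<close> on \<open>C\<^sup>\<infinity>(P) \<otimes> V\<close>, written in a basis of \<open>V\<close>.\<close>

definition vec_ext :: "(('p \<Rightarrow> complex) \<Rightarrow> ('p \<Rightarrow> complex)) \<Rightarrow> ('p \<Rightarrow> 'v) \<Rightarrow> 'p \<Rightarrow> 'v"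
  where "vec_ext D F u = (\<Sum>b\<in>basis. sc (D (\<lambda>u. coord b (F u)) u) b)"

lemma vec_ext_closed: "linear_operator D \<Longrightarrow> F \<in> carr CPV \<Longrightarrow> vec_ext D F \<in> carr CPV"
  unfolding vec_ext_def[abs_def]
  by (rule vec_sum_smooth, rule scale_smooth, rule linear_operatorD(1)[OF _ coord_smooth])

text \<open>The matrix of T has constant entries, so D passes through it; what remains is an
  exchange of two finite sums.\<close>

lemma vec_ext_linear:
  assumes D: "linear_operator D" and F: "F \<in> carr CPV" and T: "Vector_Spaces.linear sc sc T"
  shows "vec_ext D (\<lambda>u. T (F u)) u = T (vec_ext D F u)"
proof -
  interpret T: Vector_Spaces.linear sc sc T by fact
  have "coord b (T v) = (\<Sum>c\<in>basis. coord b (T c) * coord c v)" for b v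
  proof -
    have "T v = T (\<Sum>c\<in>basis. sc (coord c v) c)" by (simp add: sum_coord)
    then show ?thesis by (simp add: T.sum T.scale coord_sum coord_scale mult.commute)
  qed
  then have "(\<lambda>u. coord b (T (F u))) = (\<lambda>u. \<Sum>c\<in>basis. coord b (T c) * coord c (F u))" for b
    by blast
  then have "vec_ext D (\<lambda>u. T (F u)) u =
      (\<Sum>b\<in>basis. sc (D (\<lambda>u. \<Sum>c\<in>basis. coord b (T c) * coord c (F u)) u) b)"
    by (simp only: vec_ext_def)
  also have "\<dots> = (\<Sum>b\<in>basis. \<Sum>c\<in>basis. sc (D (\<lambda>u. coord c (F u)) u) (sc (coord b (T c)) b))"
    by (subst linear_operator_sum[OF D])
      (simp_all add: coord_smooth F V.scale_sum_left mult.commute)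
  also have "\<dots> = (\<Sum>c\<in>basis. sc (D (\<lambda>u. coord c (F u)) u) (\<Sum>b\<in>basis. sc (coord b (T c)) b))"
    by (subst sum.swap) (simp only: V.scale_sum_right)
  also have "\<dots> = T (vec_ext D F u)"
    by (simp add: sum_coord vec_ext_def T.sum T.scale)
  finally show ?thesis .
qed

text \<open>Every coordinate of the tensor is a constant multiple of f. The resulting rule mentions
  no basis and matches the one that defines \<open>tm\<close>.\<close>

lemma vec_ext_tensor:
  assumes D: "linear_operator D" and f: "f \<in> carr CP"
  shows "vec_ext D (\<lambda>u. sc (f u) w) u = sc (D f u) w"
proof -
  have "vec_ext D (\<lambda>u. sc (f u) w) u = (\<Sum>b\<in>basis. sc (D (\<lambda>u. coord b w * f u) u) b)"
    by (simp add: vec_ext_def coord_scale mult.commute)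
  also have "\<dots> = (\<Sum>b\<in>basis. sc (D f u) (sc (coord b w) b))"
    by (simp add: linear_operatorD(3)[OF D f]) (simp add: mult.commute)
  also have "\<dots> = sc (D f u) w" by (simp only: sum_coord V.scale_sum_right[symmetric])
  finally show ?thesis .
qed

lemma vec_ext_add:
  assumes D: "linear_operator D" and F: "F \<in> carr CPV" "H \<in> carr CPV"
  shows "vec_ext D (\<lambda>u. F u + H u) = (\<lambda>u. vec_ext D F u + vec_ext D H u)"
  by (simp add: vec_ext_def[abs_def] coord_add linear_operatorD(2)[OF D] coord_smooth F
      V.scale_left_distrib sum.distrib)

lemma vec_ext_scale:
  assumes D: "linear_operator D" and F: "F \<in> carr CPV"
  shows "vec_ext D (\<lambda>u. sc c (F u)) = (\<lambda>u. sc c (vec_ext D F u))"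
  by (simp add: vec_ext_def[abs_def] coord_scale linear_operatorD(3)[OF D] coord_smooth F V.scale_sum_right)

lemma act_right_smooth: "smooth_map_on (tot_atlas P) (tot_atlas P) UNIV (\<lambda>u. act P u g)"
proof -
  have "smooth_map_on (tot_atlas P) (prod_atlas (tot_atlas P) (grp_atlas P)) UNIV (\<lambda>u. (u, g))"
    by (intro smooth_map_on_Pair smooth_map_on_ident smooth_map_on_const atlases open_UNIV)
  from smooth_map_on_compose[OF atlases(1) smooth_atlas_prod[OF atlases(1,3)] atlases(1) this act_smooth]
  show ?thesis by simp
qed

lemma translate_smooth: "f \<in> carr CP \<Longrightarrow> (\<lambda>u. f (act P u g)) \<in> carr CP"
  unfolding carr_smooth_functions
  by (rule smooth_map_on_compose[OF atlases(1,1) smooth_atlas_vector[OF fin_dim_euclidean] act_right_smooth]) auto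

text \<open>Commuting with translations moves g inside; there the equivariance of F replaces the
  translation by the linear map \<pi> (g^-1), which \<open>vec_ext_linear\<close> lets out
  again.\<close>

lemma vec_ext_invariant:
  assumes D: "linear_operator D" and F: "F \<in> carr I"
    and eq: "\<And>f g. f \<in> carr CP \<Longrightarrow> D (\<lambda>u. f (act P u g)) = (\<lambda>u. D f (act P u g))"
  shows "vec_ext D F \<in> carr I"
proof -
  have F': "F \<in> carr CPV" "equivariant P \<pi> F"
    using F by (auto simp: carr_invariants carr_vec_functions)
  have "\<pi> g (vec_ext D F (act P u g)) = vec_ext D F u" for g u
  proof -
    have "vec_ext D F (act P u g) = vec_ext D (\<lambda>u. F (act P u g)) u"
      using eq[OF coord_smooth[OF F'(1)]] by (simp add: vec_ext_def)
    also have "\<dots> = \<pi> (ginv P g) (vec_ext D F u)"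
      by (simp add: equivariant_act[OF F'(2)] vec_ext_linear[OF D F'(1) linear_pi])
    finally show ?thesis by simp
  qed
  then show ?thesis
    using vec_ext_closed[OF D F'(1)] by (simp add: carr_invariants carr_vec_functions equivariant_def)
qed

lemma invariants_subset: "carr I \<subseteq> carr CPV"
  by (auto simp: carr_invariants carr_vec_functions)

lemma invariants_add: "F \<in> carr I \<Longrightarrow> H \<in> carr I \<Longrightarrow> (\<lambda>u. F u + H u) \<in> carr I"
  using vec_add_smooth[of F H]
  by (simp add: carr_invariants carr_vec_functions equivariant_def
      linear_add[OF linear_imp_real_linear[OF linear_pi]])

lemma invariants_scale:
  assumes "F \<in> carr I" shows "(\<lambda>u. sc c (F u)) \<in> carr I"
proof -
  have "linear (sc c)"
    by (rule linearI)
      (simp_all only: V.scale_right_distrib V.scale_left_commute[of c] scale_of_real[symmetric])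
  from smooth_map_on_linear[OF atlases(1) fin_dim_V fin_dim_V this] assms
  have "smooth_map_on (tot_atlas P) vector_atlas UNIV (\<lambda>u. sc c (F u))"
    by (simp add: carr_invariants)
  moreover have "\<pi> g (sc c v) = sc c (\<pi> g v)" for g v
  proof -
    interpret T: Vector_Spaces.linear sc sc "\<pi> g" by (rule linear_pi)
    show ?thesis by (rule T.scale)
  qed
  ultimately show ?thesis using assms by (simp add: carr_invariants equivariant_def)
qed

lemma invariants_zero: "(\<lambda>u. 0) \<in> carr I"
  using vec_zero_smooth
  by (simp add: carr_invariants carr_vec_functions equivariant_def
      linear_0[OF linear_imp_real_linear[OF linear_pi]])

end

section \<open>The deformed module structure\<close>

locale deformed_bundle = associated_bundle P sc \<pi>
  for P :: "('p::{t2_space,second_countable_topology}, 'ep::real_normed_vector,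
               'm::{t2_space,second_countable_topology}, 'em::real_normed_vector,
               'g::{t2_space,second_countable_topology}, 'eg::real_normed_vector) pfb"
    and sc :: "complex \<Rightarrow> 'v \<Rightarrow> 'v::real_normed_vector"
    and \<pi> :: "'g \<Rightarrow> 'v \<Rightarrow> 'v" +
  fixes star :: "(nat \<Rightarrow> 'm \<Rightarrow> complex) \<Rightarrow> (nat \<Rightarrow> 'm \<Rightarrow> complex) \<Rightarrow> (nat \<Rightarrow> 'm \<Rightarrow> complex)"
    and bul :: "(nat \<Rightarrow> 'p \<Rightarrow> complex) \<Rightarrow> (nat \<Rightarrow> 'm \<Rightarrow> complex) \<Rightarrow> (nat \<Rightarrow> 'p \<Rightarrow> complex)"
    and \<rho> :: "nat \<Rightarrow> ('p \<Rightarrow> complex) \<Rightarrow> ('m \<Rightarrow> complex) \<Rightarrow> ('p \<Rightarrow> complex)"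
  assumes star: "star_product (base_atlas P) star"
    and rho_bilinear: "cbilinear CP CM CP (\<rho> r)"
    and rho_0: "f \<in> carr CP \<Longrightarrow> a \<in> carr CM \<Longrightarrow> \<rho> 0 f a = (\<lambda>u. f u * a (prj P u))"
    and bul_eq: "h \<in> formal CP \<Longrightarrow> A \<in> formal CM \<Longrightarrow> bul h A = lambda_ext CP \<rho> h A"
    and bul_module: "right_module_structure (base_atlas P) star CP bul"
    and bul_act: "h \<in> formal CP \<Longrightarrow> A \<in> formal CM \<Longrightarrow>
      (\<lambda>n u. bul h A n (act P u g)) = bul (\<lambda>n u. h n (act P u g)) A"
begin

section \<open>The operators of the given quantization, order by order\<close>

text \<open>Follows from the form of the product as an extension of bilinear operators; needed
  wherever a module is multiplied by \<open>star a b\<close>.\<close>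

lemma star_closed:
  assumes "a \<in> formal CM" "b \<in> formal CM" shows "star a b \<in> formal CM"
proof -
  obtain C where C: "\<And>r. cbilinear CM CM CM (C r)"
      "\<And>a b. a \<in> formal CM \<Longrightarrow> b \<in> formal CM \<Longrightarrow> star a b = lambda_ext CM C a b"
    using star unfolding star_product_def Let_def bidifferential_def by blast
  show ?thesis
    unfolding C(2)[OF assms]
    by (rule lambda_ext_closed[OF _ _ _ assms])
      (use C(1) in \<open>auto simp: cbilinear_def intro!: smooth_functions_add smooth_functions_const atlases\<close>)
qed

lemma formal_one: "formal_one \<in> formal CM"
  unfolding formal_def formal_one_def by (simp add: smooth_functions_const[OF atlases(2)])

lemma rho_linear: "a \<in> carr CM \<Longrightarrow> linear_operator (\<lambda>f. \<rho> r f a)"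
  using rho_bilinear[of r] unfolding cbilinear_def linear_operator_def by simp

lemma rho_add: "f \<in> carr CP \<Longrightarrow> a \<in> carr CM \<Longrightarrow> a' \<in> carr CM \<Longrightarrow>
    \<rho> r f (\<lambda>x. a x + a' x) = (\<lambda>u. \<rho> r f a u + \<rho> r f a' u)"
  using rho_bilinear[of r] unfolding cbilinear_def by simp

lemma rho_scale: "f \<in> carr CP \<Longrightarrow> a \<in> carr CM \<Longrightarrow> \<rho> r f (\<lambda>x. c * a x) = (\<lambda>u. c * \<rho> r f a u)"
  using rho_bilinear[of r] unfolding cbilinear_def by simp

lemma rho_zero: "f \<in> carr CP \<Longrightarrow> \<rho> r f (\<lambda>x. 0) = (\<lambda>u. 0)"
  using rho_scale[of f "\<lambda>x. 0" r 0] smooth_functions_const[OF atlases(2)] by simp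

lemma bul_sum:
  "h \<in> formal CP \<Longrightarrow> A \<in> formal CM \<Longrightarrow>
    bul h A n u = (\<Sum>r\<le>n. \<Sum>i\<le>n - r. \<rho> r (h i) (A (n - r - i)) u)"
  by (simp add: bul_eq lambda_ext_pointwise)

text \<open>With both series concentrated in order 0, only the summand with q = r and i = 0 can be
  nonzero. This recovers each operator from \<open>bul\<close>.\<close>

lemma bul_order_zero:
  assumes f: "f \<in> carr CP" and a: "a \<in> carr CM"
  shows "bul (\<lambda>n u. if n = 0 then f u else 0) (\<lambda>n x. if n = 0 then a x else 0) r u = \<rho> r f a u"
proof -
  have z: "(\<lambda>u. 0) \<in> carr CP" "(\<lambda>u. 0) \<in> carr CM"
    by (auto intro: smooth_functions_const atlases)
  have "bul (\<lambda>n u. if n = 0 then f u else 0) (\<lambda>n x. if n = 0 then a x else 0) r u =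
      (\<Sum>q\<le>r. \<Sum>i\<le>r - q. \<rho> q (\<lambda>u. if i = 0 then f u else 0) (\<lambda>x. if r - q - i = 0 then a x else 0) u)"
    by (rule bul_sum) (intro constant_series_formal atlases f a)+
  also have "\<dots> = (\<Sum>q\<le>r. if q = r then \<rho> r f a u else 0)"
  proof (intro sum.cong refl)
    fix q assume "q \<in> {..r}"
    then show "(\<Sum>i\<le>r - q. \<rho> q (\<lambda>u. if i = 0 then f u else 0) (\<lambda>x. if r - q - i = 0 then a x else 0) u) =
        (if q = r then \<rho> r f a u else 0)"
    proof (cases "q = r")
      case False
      \<comment> \<open>For q < r one of the two arguments is the zero function: the second if i =
        0, the first otherwise.\<close>
      have "\<rho> q (\<lambda>u. if i = 0 then f u else 0) (\<lambda>x. if r - q - i = 0 then a x else 0) u = 0" for i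
      proof (cases "i = 0")
        case True
        with False \<open>q \<in> {..r}\<close> show ?thesis by (simp add: rho_zero[OF f])
      next
        case False
        have "(\<lambda>x. if r - q - i = 0 then a x else 0) \<in> carr CM"
          using a z by (cases "r - q - i = 0") simp_all
        from linear_operator_zero[OF rho_linear[OF this]] False show ?thesis by simp
      qed
      with False show ?thesis by simp
    qed simp
  qed
  finally show ?thesis by simp
qed

text \<open>Compares the coefficients of order r in the equivariance of \<open>bul\<close>, applied
  to series concentrated in order 0.\<close>

lemma rho_act:
  assumes f: "f \<in> carr CP" and a: "a \<in> carr CM"
  shows "\<rho> r (\<lambda>u. f (act P u g)) a = (\<lambda>u. \<rho> r f a (act P u g))"
proof
  fix u
  let ?f = "\<lambda>n u. if n = (0::nat) then f u else 0" and ?a = "\<lambda>n x. if n = (0::nat) then a x else 0"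
  have "?f \<in> formal CP" "?a \<in> formal CM" by (intro constant_series_formal atlases f a)+
  from fun_cong[OF fun_cong[OF bul_act[OF this, of g], of r], of u]
  show "\<rho> r (\<lambda>u. f (act P u g)) a u = \<rho> r f a (act P u g)"
    by (simp add: bul_order_zero f a translate_smooth)
qed

section \<open>The multiplication on V-valued series\<close>

definition "rho_vec r F a = vec_ext (\<lambda>f. \<rho> r f a) F"

definition "bul_vec = lambda_ext CPV rho_vec"

lemma rho_vec_closed: "F \<in> carr CPV \<Longrightarrow> a \<in> carr CM \<Longrightarrow> rho_vec r F a \<in> carr CPV"
  unfolding rho_vec_def by (rule vec_ext_closed[OF rho_linear])

lemma rho_vec_add_right:
  "F \<in> carr CPV \<Longrightarrow> a \<in> carr CM \<Longrightarrow> a' \<in> carr CM \<Longrightarrow>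
    rho_vec r F (\<lambda>x. a x + a' x) = (\<lambda>u. rho_vec r F a u + rho_vec r F a' u)"
  by (simp add: rho_vec_def vec_ext_def[abs_def] rho_add coord_smooth V.scale_left_distrib sum.distrib)

lemma rho_vec_scale_right:
  "F \<in> carr CPV \<Longrightarrow> a \<in> carr CM \<Longrightarrow> rho_vec r F (\<lambda>x. c * a x) = (\<lambda>u. sc c (rho_vec r F a u))"
  by (simp add: rho_vec_def vec_ext_def[abs_def] rho_scale coord_smooth V.scale_sum_right)

text \<open>The place where the equivariance of \<rho> r enters: it keeps the values in
  \<open>I\<close>.\<close>

lemma rho_vec_bilinear: "cbilinear I CM I (rho_vec r)"
  using invariants_subset rho_vec_add_right rho_vec_scale_right
    vec_ext_invariant[OF rho_linear _ rho_act] vec_ext_add[OF rho_linear] vec_ext_scale[OF rho_linear]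
  unfolding cbilinear_def by (simp add: rho_vec_def subset_iff)

lemma rho_vec_0:
  assumes "F \<in> carr CPV" "a \<in> carr CM"
  shows "rho_vec 0 F a = (\<lambda>u. sc (a (prj P u)) (F u))"
proof
  fix u
  have "rho_vec 0 F a u = (\<Sum>b\<in>basis. sc (a (prj P u)) (sc (coord b (F u)) b))"
    by (simp add: rho_vec_def vec_ext_def rho_0 coord_smooth assms mult.commute)
  then show "rho_vec 0 F a u = sc (a (prj P u)) (F u)"
    by (simp only: sum_coord V.scale_sum_right[symmetric])
qed

lemma bul_vec_sum: "bul_vec F A n u = (\<Sum>r\<le>n. \<Sum>i\<le>n - r. rho_vec r (F i) (A (n - r - i)) u)"
  by (simp add: bul_vec_def lambda_ext_pointwise)

lemma coord_formal: "F \<in> formal CPV \<Longrightarrow> (\<lambda>m u. coord b (F m u)) \<in> formal CP"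
  by (simp add: formal_def coord_smooth)

text \<open>Exchanges the sum over the basis with the sums over the orders. This makes the module
  axioms of \<open>bul\<close> available coordinate by coordinate.\<close>

lemma bul_vec_coord_sum:
  assumes "F \<in> formal CPV" "A \<in> formal CM"
  shows "bul_vec F A n u = (\<Sum>b\<in>basis. sc (bul (\<lambda>m u. coord b (F m u)) A n u) b)"
  unfolding bul_sum[OF coord_formal[OF assms(1)] assms(2)] bul_vec_sum rho_vec_def vec_ext_def V.scale_sum_left
  by (simp only: sum.swap[of _ basis])

lemma coord_bul_vec:
  assumes "F \<in> formal CPV" "A \<in> formal CM" "b \<in> basis"
  shows "coord b (bul_vec F A n u) = bul (\<lambda>m u. coord b (F m u)) A n u"
  unfolding bul_vec_coord_sum[OF assms(1,2)] by (rule coord_combination[OF assms(3)])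

lemma bul_vec_closed: "F \<in> formal CPV \<Longrightarrow> A \<in> formal CM \<Longrightarrow> bul_vec F A \<in> formal CPV"
  unfolding bul_vec_def
  by (rule lambda_ext_closed) (auto intro: vec_add_smooth vec_zero_smooth rho_vec_closed)

lemma bul_vec_invariant: "F \<in> formal I \<Longrightarrow> A \<in> formal CM \<Longrightarrow> bul_vec F A \<in> formal I"
proof -
  assume FA: "F \<in> formal I" "A \<in> formal CM"
  have "lambda_ext I rho_vec F A \<in> formal I"
    by (rule lambda_ext_closed[OF _ _ _ FA])
      (use rho_vec_bilinear in \<open>auto simp: cbilinear_def intro: invariants_add invariants_zero\<close>)
  \<comment> \<open>Invariant and arbitrary V-valued functions share their addition and zero, so
    both extensions are the same series.\<close>
  moreover have "lambda_ext I rho_vec F A = bul_vec F A"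
    by (simp add: fun_eq_iff bul_vec_sum lambda_ext_pointwise)
  ultimately show ?thesis by simp
qed

lemma bul_vec_one:
  assumes "F \<in> formal CPV" shows "bul_vec F formal_one = F"
proof (intro ext)
  fix n u
  have "bul (\<lambda>m u. coord b (F m u)) formal_one = (\<lambda>m u. coord b (F m u))" for b
    using bul_module coord_formal[OF assms] by (simp add: right_module_structure_def)
  then show "bul_vec F formal_one n u = F n u"
    by (simp add: bul_vec_coord_sum[OF assms formal_one] sum_coord)
qed

lemma bul_vec_assoc:
  assumes F: "F \<in> formal CPV" and A: "A \<in> formal CM" and B: "B \<in> formal CM"
  shows "bul_vec (bul_vec F A) B = bul_vec F (star A B)"
proof (intro ext)
  fix n u
  have "(\<lambda>m u. coord b (bul_vec F A m u)) = bul (\<lambda>m u. coord b (F m u)) A" if "b \<in> basis" for b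
    by (simp add: coord_bul_vec[OF F A that])
  moreover have "bul (bul (\<lambda>m u. coord b (F m u)) A) B = bul (\<lambda>m u. coord b (F m u)) (star A B)" for b
    using bul_module coord_formal[OF F] A B by (simp add: right_module_structure_def)
  ultimately show "bul_vec (bul_vec F A) B n u = bul_vec F (star A B) n u"
    by (simp add: bul_vec_coord_sum F A B bul_vec_closed star_closed)
qed

text \<open>Ensures that a statement about every admissible \<open>tm\<close> is not
  vacuous.\<close>

lemma tensor_multiplication_bul_vec: "tensor_multiplication P sc bul bul_vec"
proof -
  have "bul_vec (\<lambda>n u. F n u + H n u) A = (\<lambda>n u. bul_vec F A n u + bul_vec H A n u)"
    if "F \<in> formal CPV" "H \<in> formal CPV" "A \<in> formal CM" for F H A
  proof -
    have "rho_vec r (\<lambda>u. F i u + H i u) (A j) u = rho_vec r (F i) (A j) u + rho_vec r (H i) (A j) u"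
      for r i j u
      unfolding rho_vec_def
      by (subst vec_ext_add[OF rho_linear]) (use that in \<open>auto simp: formal_def\<close>)
    then show ?thesis by (simp add: fun_eq_iff bul_vec_sum sum.distrib)
  qed
  moreover have "bul_vec (tensor sc h w) A = tensor sc (bul h A) w"
    if "h \<in> formal CP" "A \<in> formal CM" for h w A
  proof -
    have "rho_vec r (\<lambda>u. sc (h i u) w) (A j) u = sc (\<rho> r (h i) (A j) u) w" for r i j u
      unfolding rho_vec_def
      by (rule vec_ext_tensor[OF rho_linear]) (use that in \<open>auto simp: formal_def\<close>)
    then show ?thesis
      by (simp add: fun_eq_iff bul_vec_sum tensor_def bul_sum[OF that] V.scale_sum_left)
  qed
  ultimately show ?thesis by (simp add: tensor_multiplication_def Let_def)
qed

text \<open>F is the finite sum of its coordinate series tensored with the basis vectors, and on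
  these tensors \<open>tm\<close> is prescribed; additivity does the rest.\<close>

lemma tensor_multiplication_unique:
  assumes tm: "tensor_multiplication P sc bul tm" and F: "F \<in> formal CPV" and A: "A \<in> formal CM"
  shows "tm F A = bul_vec F A"
proof -
  have add: "tm (\<lambda>n u. F n u + H n u) A = (\<lambda>n u. tm F A n u + tm H A n u)"
    if "F \<in> formal CPV" "H \<in> formal CPV" for F H
    using tm that A by (simp add: tensor_multiplication_def Let_def)
  have tensor: "tm (\<lambda>n u. sc (h n u) w) A = (\<lambda>n u. sc (bul h A n u) w)" if "h \<in> formal CP" for h w
    using tm that A by (simp add: tensor_multiplication_def tensor_def Let_def)
  have "tm (\<lambda>n u. \<Sum>b\<in>S. sc (coord b (F n u)) b) A =
      (\<lambda>n u. \<Sum>b\<in>S. sc (bul (\<lambda>m u. coord b (F m u)) A n u) b)" if "finite S" for S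
    using that
  proof induction
    case empty
    \<comment> \<open>The empty sum is written as a tensor with w = 0, which makes the right-hand
      side vanish whatever value \<open>bul\<close> has.\<close>
    have "(\<lambda>n u. 0) \<in> formal CP"
      by (auto simp: formal_def intro: smooth_functions_const atlases)
    from tensor[OF this, of 0] show ?case by simp
  next
    case (insert b S)
    have "(\<lambda>n u. sc (coord b (F n u)) b) \<in> formal CPV" "(\<lambda>n u. \<Sum>b\<in>S. sc (coord b (F n u)) b) \<in> formal CPV"
      using F by (auto simp: formal_def intro!: vec_sum_smooth scale_smooth coord_smooth)
    from add[OF this] insert show ?case by (simp add: tensor[OF coord_formal[OF F]])
  qed
  from this[OF basis(1)] show ?thesis
    by (simp add: sum_coord fun_eq_iff bul_vec_coord_sum[OF F A])
qed

section \<open>Transport to sections of the associated bundle\<close>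

lemma canonical_isomorphism: "canonical_isomorphism P sc \<pi>"
proof -
  have "section_to_fun P \<pi> (vadd \<Gamma> s t) = vadd I (section_to_fun P \<pi> s) (section_to_fun P \<pi> t)"
    if "s \<in> carr \<Gamma>" "t \<in> carr \<Gamma>" for s t
    using that invariants_add
    by (auto simp: carr_sections vadd_fun_to_section section_to_fun_fun_to_section)
  moreover have "section_to_fun P \<pi> (\<lambda>x. vb_scale bundle (a x) (s x)) =
              (\<lambda>u. sc (a (prj P u)) (section_to_fun P \<pi> s u))"
    if s: "s \<in> carr \<Gamma>" and a: "a \<in> carr CM" for s a
  proof -
    obtain F where F: "F \<in> carr I" "s = fun_to_section P F" using s by (auto simp: carr_sections)
    \<comment> \<open>Multiplication by the pull-back of a is the operator of order 0, so its
      invariance is an instance of \<open>rho_vec_bilinear\<close>.\<close>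
    have "rho_vec 0 F a \<in> carr I" using rho_vec_bilinear F a by (auto simp: cbilinear_def)
    then have "(\<lambda>u. sc (a (prj P u)) (F u)) \<in> carr I"
      using rho_vec_0 F invariants_subset a by auto
    then show ?thesis
      using F by (simp add: vb_scale_fun_to_section section_to_fun_fun_to_section)
  qed
  ultimately show ?thesis
    using bij_section_to_fun by (simp add: canonical_isomorphism_def Let_def)
qed

text \<open>The axioms are proved for the explicit multiplication \<open>T\<close> built from
  \<open>bul_vec\<close>, which agrees with the transported one on formal arguments.\<close>

lemma vb_deformation_quantization:
  assumes tm: "tensor_multiplication P sc bul tm"
  shows "vb_deformation_quantization (base_atlas P) bundle star (transported_multiplication P sc \<pi> tm)"
proof -
  define R where "R r s a = fun_to_section P (rho_vec r (section_to_fun P \<pi> s) a)" for r s a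
  define T where "T s A n = fun_to_section P (bul_vec (\<lambda>m. section_to_fun P \<pi> (s m)) A n)" for s A n
  have fs: "(\<lambda>m. section_to_fun P \<pi> (s m)) \<in> formal I" if "s \<in> formal \<Gamma>" for s
    using that bij_betw_imp_surj_on[OF bij_section_to_fun] by (auto simp: formal_def)
  have IV: "formal I \<subseteq> formal CPV" using invariants_subset by (auto simp: formal_def)
  have inv: "fun_to_section P (section_to_fun P \<pi> s) = s" if "s \<in> carr \<Gamma>" for s
    using that by (auto simp: carr_sections section_to_fun_fun_to_section)
  have T: "transported_multiplication P sc \<pi> tm s A = T s A" if "s \<in> formal \<Gamma>" "A \<in> formal CM" for s A
  proof
    fix n
    have "bul_vec (\<lambda>m. section_to_fun P \<pi> (s m)) A n \<in> carr I"
      using bul_vec_invariant[OF fs] that by (simp add: formal_def)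
    moreover have "tm (\<lambda>m. section_to_fun P \<pi> (s m)) A = bul_vec (\<lambda>m. section_to_fun P \<pi> (s m)) A"
      using fs[OF that(1)] IV that(2) by (intro tensor_multiplication_unique[OF tm]) auto
    ultimately show "transported_multiplication P sc \<pi> tm s A n = T s A n"
      by (simp add: transported_multiplication_def T_def inv_section_to_fun)
  qed
  have R_fun: "R r (fun_to_section P F) a = fun_to_section P (rho_vec r F a)" if "F \<in> carr I" for r F a
    using that by (simp add: R_def section_to_fun_fun_to_section)
  have "cbilinear \<Gamma> CM \<Gamma> (R r)" for r
    using rho_vec_bilinear[of r] invariants_add invariants_scale
    unfolding cbilinear_def carr_sections
    by (auto simp: R_fun vadd_fun_to_section vscale_fun_to_section)
  moreover have "R 0 s a = (\<lambda>x. vb_scale bundle (a x) (s x))" if "s \<in> carr \<Gamma>" "a \<in> carr CM" for s a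
    using that invariants_subset by (auto simp: carr_sections R_fun vb_scale_fun_to_section rho_vec_0)
  moreover have "T s A = lambda_ext \<Gamma> R s A" for s A
  proof
    fix n
    \<comment> \<open>\<open>R\<close> ends with the map from functions to sections, so this map can
      be pulled out of the extension, leaving a sum of functions.\<close>
    have "lambda_ext \<Gamma> R s A n = fun_to_section P (lambda_ext I (\<lambda>r s. rho_vec r (section_to_fun P \<pi> s)) s A n)"
      unfolding R_def[abs_def] 
      by (rule lambda_ext_image[where \<Phi> = "fun_to_section P" and D = "\<lambda>r s. rho_vec r (section_to_fun P \<pi> s)"])
        (simp_all only: vadd_fun_to_section vzero_sections)
    also have "lambda_ext I (\<lambda>r s. rho_vec r (section_to_fun P \<pi> s)) s A n =
        bul_vec (\<lambda>m. section_to_fun P \<pi> (s m)) A n"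
      by (simp add: fun_eq_iff bul_vec_sum lambda_ext_pointwise)
    finally show "T s A n = lambda_ext \<Gamma> R s A n" by (simp add: T_def)
  qed
  moreover have "T s A \<in> formal \<Gamma>" if "s \<in> formal \<Gamma>" "A \<in> formal CM" for s A
    using bul_vec_invariant[OF fs] that by (auto simp: formal_def T_def carr_sections)
  moreover have "T s formal_one = s" if "s \<in> formal \<Gamma>" for s
  proof -
    have "bul_vec (\<lambda>m. section_to_fun P \<pi> (s m)) formal_one = (\<lambda>m. section_to_fun P \<pi> (s m))"
      using fs[OF that] IV by (intro bul_vec_one) auto
    then show ?thesis using that inv by (simp add: T_def[abs_def] formal_def)
  qed
  moreover have "T (T s A) B = T s (star A B)" if "s \<in> formal \<Gamma>" "A \<in> formal CM" "B \<in> formal CM" for s A B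
  proof -
    have "section_to_fun P \<pi> (T s A m) = bul_vec (\<lambda>m. section_to_fun P \<pi> (s m)) A m" for m
      using bul_vec_invariant[OF fs] that
      by (simp add: T_def formal_def section_to_fun_fun_to_section)
    then have "(\<lambda>m. section_to_fun P \<pi> (T s A m)) = bul_vec (\<lambda>m. section_to_fun P \<pi> (s m)) A"
      by blast
    moreover have "bul_vec (bul_vec (\<lambda>m. section_to_fun P \<pi> (s m)) A) B =
        bul_vec (\<lambda>m. section_to_fun P \<pi> (s m)) (star A B)"
      using fs[OF that(1)] IV by (intro bul_vec_assoc that(2,3)) auto
    ultimately show ?thesis unfolding T_def[of "T s A", abs_def] by (simp add: T_def[abs_def])
  qed
  ultimately have "vb_deformation_quantization (base_atlas P) bundle star T"
    unfolding vb_deformation_quantization_def Let_def right_module_structure_def by blast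
  \<comment> \<open>Replacing \<open>T\<close> inside the associativity law relies on the inner
    products being formal series again.\<close>
  then show ?thesis
    unfolding vb_deformation_quantization_def Let_def right_module_structure_def
    by (simp add: T formal_one star_closed)
qed

end

theorem theorem6p2:
  fixes P :: "('p::{t2_space,second_countable_topology}, 'ep::real_normed_vector,
               'm::{t2_space,second_countable_topology}, 'em::real_normed_vector,
               'g::{t2_space,second_countable_topology}, 'eg::real_normed_vector) pfb"
    and star :: "(nat \<Rightarrow> 'm \<Rightarrow> complex) \<Rightarrow> (nat \<Rightarrow> 'm \<Rightarrow> complex) \<Rightarrow> (nat \<Rightarrow> 'm \<Rightarrow> complex)"
    and bul :: "(nat \<Rightarrow> 'p \<Rightarrow> complex) \<Rightarrow> (nat \<Rightarrow> 'm \<Rightarrow> complex) \<Rightarrow> (nat \<Rightarrow> 'p \<Rightarrow> complex)"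
    and sc :: "complex \<Rightarrow> 'v \<Rightarrow> 'v::real_normed_vector"
    and \<pi> :: "'g \<Rightarrow> 'v \<Rightarrow> 'v"
  assumes "principal_fibre_bundle P"
    and "star_product (base_atlas P) star"
    and "pfb_deformation_quantization P star bul"
    and "fin_dim_complex sc"
    and "lie_representation P sc \<pi>"
  shows "canonical_isomorphism P sc \<pi> \<and>
    (\<exists>tm. tensor_multiplication P sc bul tm) \<and>
    (\<forall>tm. tensor_multiplication P sc bul tm \<longrightarrow>
       (\<forall>F \<in> formal (invariants P sc \<pi>). \<forall>a \<in> formal (smooth_functions (base_atlas P)).
          tm F a \<in> formal (invariants P sc \<pi>)) \<and>
       vb_deformation_quantization (base_atlas P) (assoc_bundle P sc \<pi>) star
         (transported_multiplication P sc \<pi> tm))"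
proof -
  define CM CP where "CM = smooth_functions (base_atlas P)" and "CP = smooth_functions (tot_atlas P)"
  obtain \<rho> where \<rho>: "\<forall>r. bidifferential CP CM CP (\<lambda>u. u) (prj P) (\<rho> r)"
    "\<forall>f\<in>carr CP. \<forall>a\<in>carr CM. \<rho> 0 f a = (\<lambda>u. f u * a (prj P u))"
    "\<forall>f\<in>formal CP. \<forall>a\<in>formal CM. bul f a = lambda_ext CP \<rho> f a"
    using assms(3) unfolding pfb_deformation_quantization_def Let_def CM_def CP_def by blast
  \<comment> \<open>The operators exist only under a quantifier in the hypothesis; a fixed witness
    becomes a parameter of the locale.\<close>
  interpret deformed_bundle P sc \<pi> star bul \<rho>
  proof
    show "cbilinear (smooth_functions (tot_atlas P)) (smooth_functions (base_atlas P))
        (smooth_functions (tot_atlas P)) (\<rho> r)" for r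
      using \<rho>(1) by (simp add: bidifferential_def CM_def CP_def)
  qed (use assms \<rho>(2,3) in \<open>simp_all add: pfb_deformation_quantization_def Let_def CM_def CP_def\<close>)
  have "formal I \<subseteq> formal CPV" using invariants_subset by (auto simp: formal_def)
  then have "tm F a \<in> formal I"
    if "tensor_multiplication P sc bul tm" "F \<in> formal I" "a \<in> formal (smooth_functions (base_atlas P))" for tm F a
    using tensor_multiplication_unique[OF that(1)] bul_vec_invariant[OF that(2,3)] that(2,3) by auto
  then show ?thesis
    using canonical_isomorphism tensor_multiplication_bul_vec vb_deformation_quantization by blast
qed

end
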